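(* Let $f$ be a probability density on $\mathbb{R}$ with unit second moment which is $g$-concentrated (with error functions $\lambda_n$), with $\|f\|_\infty<\infty$, and assume $\sup_n\sup_u|\lambda_n(u)|<(2\pi)^{-1/2}$. Suppose $f(v)\ge e^{-\Phi(v)}$ for a positive function $\Phi$, and that for some $\beta>0$ $$M_{\Phi,\beta}=\int_{\mathbb{R}}\Phi(v)^{1+\beta}f(v)dv<\infty,\qquad M_{avg,\Phi,\beta}=\int_{\mathbb{R}^2}\left(\int_0^{2\pi}\Phi(v_1\cos\theta+v_2\sin\theta)^{1+\beta}d\theta\right)f(v_1)f(v_2)dv_1dv_2<\infty.$$ Then the conditioned tensorisations $F_N$ of $f$, $N\ge3$, have the log-power property of order $\beta$, with constant (for any $\epsilon>0$) $$C=\left[2^{1+2\beta}\sqrt3\,\frac{\|g\|_\infty+\sup|\lambda_{N-1}|}{(2\pi)^{-1/2}-\sup|\lambda_N|}\left(2\left(C_\epsilon\|f\|_\infty^\epsilon\right)^{1+\beta}+M_{\Phi,\beta}+M_{avg,\Phi,\beta}\right)\right]^{\frac1{1+\beta}},$$ where $C_\epsilon=\sup_{x\ge1}\frac{\log x}{x^\epsilon}$ and the suprema of $|\lambda_n|$ are taken over all $n$ and all arguments.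
   Context: $\mathbb{S}^{N-1}(r)$ is the sphere of radius $r$ in $\mathbb{R}^N$ with uniform probability measure $d\sigma^N_r$ ($d\sigma^N=d\sigma^N_{\sqrt N}$); $|\mathbb{S}^{n-1}|$ is the surface area of the unit sphere in $\mathbb{R}^n$. For a probability density $f$ on $\mathbb{R}$ with unit second moment, $\mathcal{Z}_N(f,r)=\int_{\mathbb{S}^{N-1}(r)}f^{\otimes N}d\sigma^N_r$ and the conditioned tensorisation is $F_N=f^{\otimes N}/\mathcal{Z}_N(f,\sqrt N)$. $f$ is $g$-concentrated if $\mathcal{Z}_N$ is well defined and for each fixed $k$, $\mathcal{Z}_{N-k}(f,\sqrt u)=\frac{2}{(N-k)^{1/2}|\mathbb{S}^{N-k-1}|u^{(N-k-2)/2}}\left(g(u-(N-k),N-k)+\lambda_{N-k}(u)\right)$, where $g$ is non-negative and bounded, $g(0,N)=(2\pi)^{-1/2}$ for all $N$, $\lim_{N\to\infty}\sup_u|\lambda_N(u)|=0$, and for every $R>0$, $\lim_{N\to\infty}\sup_{|x|<R}|g(x,N)-(2\pi)^{-1/2}|=0$. $R_{1,2,\theta}$ is the rotation $v_1\mapsto v_1\cos\theta+v_2\sin\theta$, $v_2\mapsto-v_1\sin\theta+v_2\cos\theta$, other coordinates fixed. A family $\{F_N\}$ has the log-power property of order $\beta>0$ with constant $C>0$ (independent of $N$) if $\frac1{2\pi}\int_0^{2\pi}\int_{\mathbb{S}^{N-1}(\sqrt N)}\psi_\beta(F_N,F_N\circ R_{1,2,\theta})d\sigma^Nd\theta\le C^{1+\beta}$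 for all $N$, where $\psi_\beta(x,y)=|x-y|\,|\log(x/y)|^{1+\beta}$. *)

theory Defs
  imports "HOL-Probability.Probability"
begin

text \<open>Points of R^N are represented as extensional functions nat => real on {..<N}
  (coordinates v_1,...,v_N are v 0, ..., v (N-1)), with the product Lebesgue measure.\<close>

definition RN :: "nat \<Rightarrow> (nat \<Rightarrow> real) measure" where
  "RN N = PiM {..<N} (\<lambda>_. lborel)"

definition enorm :: "nat \<Rightarrow> (nat \<Rightarrow> real) \<Rightarrow> real" where
  "enorm N v = sqrt (\<Sum>i<N. (v i)^2)"

definition ball_N :: "nat \<Rightarrow> real \<Rightarrow> (nat \<Rightarrow> real) set" where
  "ball_N N r = {v \<in> PiE {..<N} (\<lambda>_. UNIV). enorm N v < r}"

text \<open>Uniform probability measure on the sphere S^{N-1}(r) (the normalised surface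
  measure), realised as the cone measure: push forward of the uniform distribution on the
  ball of radius r under radial projection x \<mapsto> r x/|x|.\<close>
definition sphere_measure :: "nat \<Rightarrow> real \<Rightarrow> (nat \<Rightarrow> real) measure" where
  "sphere_measure N r =
     distr (uniform_measure (RN N) (ball_N N r)) (RN N)
           (\<lambda>x. restrict (\<lambda>i. r * x i / enorm N x) {..<N})"

text \<open>|S^{n-1}|: surface area of the unit sphere in R^n.\<close>
definition sphere_area :: "nat \<Rightarrow> real" where
  "sphere_area n = 2 * pi powr (real n / 2) / Gamma (real n / 2)"

definition tensor :: "(real \<Rightarrow> real) \<Rightarrow> nat \<Rightarrow> (nat \<Rightarrow> real) \<Rightarrow> real" where
  "tensor f N v = (\<Prod>i<N. f (v i))"

definition ZZ :: "(real \<Rightarrow> real) \<Rightarrow> nat \<Rightarrow> real \<Rightarrow> real" where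
  "ZZ f N r = integral\<^sup>L (sphere_measure N r) (tensor f N)"

definition cond_tensor :: "(real \<Rightarrow> real) \<Rightarrow> nat \<Rightarrow> (nat \<Rightarrow> real) \<Rightarrow> real" where
  "cond_tensor f N v = tensor f N v / ZZ f N (sqrt (real N))"

definition prob_density_unit_moment :: "(real \<Rightarrow> real) \<Rightarrow> bool" where
  "prob_density_unit_moment f \<longleftrightarrow>
     f \<in> borel_measurable borel \<and> (\<forall>v. 0 \<le> f v) \<and>
     has_bochner_integral lborel f 1 \<and>
     has_bochner_integral lborel (\<lambda>v. v^2 * f v) 1"

definition g_concentrated ::
  "(real \<Rightarrow> real) \<Rightarrow> (real \<Rightarrow> nat \<Rightarrow> real) \<Rightarrow> (nat \<Rightarrow> real \<Rightarrow> real) \<Rightarrow> bool" where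
  "g_concentrated f g lam \<longleftrightarrow>
     (\<forall>n\<ge>1. \<forall>r>0. integrable (sphere_measure n r) (tensor f n)) \<and>
     (\<forall>n\<ge>1. \<forall>u>0. ZZ f n (sqrt u) =
        2 / (sqrt (real n) * sphere_area n * u powr ((real n - 2) / 2))
          * (g (u - real n) n + lam n u)) \<and>
     (\<forall>x n. 0 \<le> g x n) \<and> (\<exists>B. \<forall>x n. g x n \<le> B) \<and>
     (\<forall>n. g 0 n = (2 * pi) powr (-1/2)) \<and>
     (\<forall>e>0. \<exists>N0. \<forall>n\<ge>N0. \<forall>u>0. \<bar>lam n u\<bar> < e) \<and>
     (\<forall>R>0. \<forall>e>0. \<exists>N0. \<forall>n\<ge>N0. \<forall>x. \<bar>x\<bar> < R \<longrightarrow> \<bar>g x n - (2 * pi) powr (-1/2)\<bar> < e)"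

definition rot12 :: "real \<Rightarrow> (nat \<Rightarrow> real) \<Rightarrow> (nat \<Rightarrow> real)" where
  "rot12 \<theta> v = v(0 := v 0 * cos \<theta> + v 1 * sin \<theta>, 1 := - v 0 * sin \<theta> + v 1 * cos \<theta>)"

definition psi :: "real \<Rightarrow> real \<Rightarrow> real \<Rightarrow> real" where
  "psi \<beta> x y = \<bar>x - y\<bar> * \<bar>ln (x / y)\<bar> powr (1 + \<beta>)"

definition log_power_property ::
  "nat set \<Rightarrow> (nat \<Rightarrow> (nat \<Rightarrow> real) \<Rightarrow> real) \<Rightarrow> real \<Rightarrow> real \<Rightarrow> bool" where
  "log_power_property Ns F \<beta> C \<longleftrightarrow> 0 < \<beta> \<and> 0 < C \<and>
     (\<forall>N\<in>Ns. ennreal (1 / (2 * pi)) *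
        (\<integral>\<^sup>+ \<theta>. (\<integral>\<^sup>+ v. ennreal (psi \<beta> (F N v) (F N (rot12 \<theta> v)))
                       \<partial>sphere_measure N (sqrt (real N))) * indicator {0..2*pi} \<theta> \<partial>lborel)
      \<le> ennreal (C powr (1 + \<beta>)))"

end

theory Submission
  imports Defs
begin

text \<open>
  Since \<open>f\<^sup>\<otimes>\<^sup>N\<close> and its rotation differ only in the factors of the first two coordinates, \<open>\<psi>\<^sub>\<beta>\<close> of the pair is a
  function of these two coordinates times the tensor power in the remaining \<open>N - 2\<close> ones. Slicing the
  sphere along the first two coordinates turns the latter into \<open>Z\<^bsub>N-2\<^esub>\<close>, whose concentrated form cancels the
  geometric density, and what is left is at most \<open>sqrt 3 (|g| + |\<lambda>|) / ((2\<pi>)\<^sup>-\<^sup>1\<^sup>/\<^sup>2 - |\<lambda>|)\<close> times an integral over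
  the plane with Lebesgue measure. There \<open>|x - y|\<close> is at most the larger of \<open>x = f(v\<^sub>1) f(v\<^sub>2)\<close> and
  \<open>y = f(w\<^sub>1) f(w\<^sub>2)\<close>, and \<open>|log (x/y)|\<close> is bounded using \<open>log f \<le> C\<^sub>\<epsilon> |f|\<^sup>\<epsilon>\<close> for the larger and \<open>log f \<ge> - \<Phi>\<close> for
  the smaller product. Rotation invariance in the plane makes \<open>f(v\<^sub>1) f(v\<^sub>2)\<close> the weight in both cases, and
  periodicity in \<open>\<theta>\<close> reduces the four resulting moments of \<open>\<Phi>\<close> to the averaged one.
\<close>

subsection \<open>Euclidean space and the uniform measure on spheres\<close>

text \<open>The sphere measure is given as a radial projection of Lebesgue measure on a ball, so the
  law of two coordinates has to be computed from volumes. Slicing goes one coordinate at a time: in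
  R^(m+1) the ball is described by one coordinate and polar coordinates in the other m, and the
  slope between the two is what radial projection preserves. Two slices give
  \<open>(v 0, v 1)\<close> a density proportional to N - v_1^2 - v_2^2 to the power (m-2)/2 with m
  = N - 2, which is the power in the denominator of the concentrated form of Z_m. The numerator
  needs the bound on \<open>g\<close> at all arguments. The denominator is taken at u = N only,
  where g(0,N) is exactly (2 pi)^(-1/2). The 3 under the root bounds N/(N-2), the remainder of the
  prefactors of the two normalisations. The power 4^beta comes from splitting the logarithm into
  four summands by convexity, the other factor 2 from adding the bounds for the two orderings of the
  products.\<close>

definition vscale :: "nat \<Rightarrow> real \<Rightarrow> (nat \<Rightarrow> real) \<Rightarrow> nat \<Rightarrow> real" where
  "vscale n c x = restrict (\<lambda>i. c * x i) {..<n}"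

text \<open>The new coordinate is placed at index 0 because \<open>rot12\<close> acts on the
  coordinates 0 and 1: two applications of \<open>vcons\<close> expose exactly these and leave a
  point of R^m in the shifted indices.\<close>

definition vcons :: "nat \<Rightarrow> real \<Rightarrow> (nat \<Rightarrow> real) \<Rightarrow> nat \<Rightarrow> real" where
  "vcons n z y = restrict (case_nat z y) {..<Suc n}"

lemma vcons_0 [simp]: "vcons n z y 0 = z"
  by (simp add: vcons_def)

lemma vcons_Suc [simp]: "i < n \<Longrightarrow> vcons n z y (Suc i) = y i"
  by (simp add: vcons_def)

lemma vscale_vscale [simp]: "vscale n a (vscale n b x) = vscale n (a * b) x"
  by (auto simp: vscale_def fun_eq_iff)

lemma vscale_vcons: "vscale (Suc n) c (vcons n z y) = vcons n (c * z) (vscale n c y)"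
  by (auto simp: vscale_def vcons_def fun_eq_iff split: nat.splits)

lemma enorm_nonneg [simp]: "0 \<le> enorm n x"
  by (simp add: enorm_def sum_nonneg)

lemma enorm_vscale: "enorm n (vscale n c x) = \<bar>c\<bar> * enorm n x"
  by (simp add: enorm_def vscale_def power_mult_distrib sum_distrib_left[symmetric] real_sqrt_mult)

lemma enorm_vcons: "enorm (Suc n) (vcons n z y) = sqrt (z\<^sup>2 + (enorm n y)\<^sup>2)"
proof -
  have "(\<Sum>i<Suc n. (vcons n z y i)\<^sup>2) = z\<^sup>2 + (\<Sum>i<n. (y i)\<^sup>2)"
    by (subst sum.lessThan_Suc_shift) simp
  then show ?thesis
    by (simp add: enorm_def sum_nonneg)
qed

section \<open>Lebesgue measure on R^n, one coordinate at a time\<close>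

lemma space_RN: "space (RN n) = PiE {..<n} (\<lambda>_. UNIV)"
  by (simp add: RN_def space_PiM)

lemma measurable_RN_component:
  assumes "g \<in> measurable M (RN n)" "i < n"
  shows "(\<lambda>x. g x i) \<in> borel_measurable M"
proof -
  have "(\<lambda>x. g x i) \<in> measurable M lborel"
    by (rule measurable_compose[OF assms(1)], unfold RN_def, rule measurable_component_singleton)
       (use assms(2) in simp)
  then show ?thesis by simp
qed

lemma enorm_measurable [measurable (raw)]:
  assumes [measurable]: "g \<in> measurable M (RN n)"
  shows "(\<lambda>x. enorm n (g x)) \<in> borel_measurable M"
proof -
  have "(\<lambda>x. \<Sum>i<n. (g x i)\<^sup>2) \<in> borel_measurable M"
    using assms by (intro borel_measurable_sum borel_measurable_power measurable_RN_component) auto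
  then show ?thesis unfolding enorm_def by measurable
qed

lemma vscale_measurable [measurable (raw)]:
  assumes [measurable]: "f \<in> borel_measurable M" "g \<in> measurable M (RN n)"
  shows "(\<lambda>x. vscale n (f x) (g x)) \<in> measurable M (RN n)"
  unfolding vscale_def
  by (subst RN_def, rule measurable_restrict)
     (auto intro!: borel_measurable_times measurable_RN_component[OF assms(2)])

lemma vcons_measurable [measurable (raw)]:
  assumes [measurable]: "f \<in> borel_measurable M" "g \<in> measurable M (RN n)"
  shows "(\<lambda>x. vcons n (f x) (g x)) \<in> measurable M (RN (Suc n))"
  unfolding vcons_def
proof (subst RN_def, rule measurable_restrict)
  fix i assume "i \<in> {..<Suc n}"
  then show "(\<lambda>x. case_nat (f x) (g x) i) \<in> measurable M lborel"
    by (cases i) (auto intro!: measurable_RN_component[OF assms(2)])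
qed

lemma ball_N_sets [measurable]: "ball_N n r \<in> sets (RN n)"
proof -
  have "ball_N n r = {x \<in> space (RN n). enorm n x < r}"
    by (auto simp: ball_N_def space_RN)
  then show ?thesis by simp
qed

lemma sigma_finite_RN: "sigma_finite_measure (RN n)"
proof -
  interpret product_sigma_finite "\<lambda>_::nat. lborel :: real measure"
    by standard
  show ?thesis unfolding RN_def by (rule sigma_finite) simp
qed

text \<open>A product measure is determined by its values on boxes, and the preimage of a box under
  \<open>vcons\<close> is its side at index 0 times the box of the remaining sides, shifted by
  one.\<close>

lemma RN_Suc_eq_distr:
  "RN (Suc m) = distr (lborel \<Otimes>\<^sub>M RN m) (RN (Suc m)) (\<lambda>(z, y). vcons m z y)"
proof -
  interpret product_sigma_finite "\<lambda>_::nat. lborel :: real measure"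
    by standard
  interpret R: sigma_finite_measure "RN m" by (rule sigma_finite_RN)
  have "distr (lborel \<Otimes>\<^sub>M RN m) (RN (Suc m)) (\<lambda>(z, y). vcons m z y) = PiM {..<Suc m} (\<lambda>_. lborel)"
  proof (rule PiM_eqI)
    fix A :: "nat \<Rightarrow> real set"
    assume A: "\<And>i. i \<in> {..<Suc m} \<Longrightarrow> A i \<in> sets lborel"
    have S: "Pi\<^sub>E {..<Suc m} A \<in> sets (RN (Suc m))"
      unfolding RN_def using A by (intro sets_PiM_I_finite) auto
    have S': "Pi\<^sub>E {..<m} (\<lambda>i. A (Suc i)) \<in> sets (RN m)"
      unfolding RN_def using A by (intro sets_PiM_I_finite) auto
    have eq: "(\<lambda>(z, y). vcons m z y) -` Pi\<^sub>E {..<Suc m} A \<inter> space (lborel \<Otimes>\<^sub>M RN m)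
        = A 0 \<times> Pi\<^sub>E {..<m} (\<lambda>i. A (Suc i))"
    proof (intro set_eqI iffI)
      fix p assume p: "p \<in> (\<lambda>(z, y). vcons m z y) -` Pi\<^sub>E {..<Suc m} A \<inter> space (lborel \<Otimes>\<^sub>M RN m)"
      obtain z y where zy: "p = (z, y)" by (cases p)
      have y: "y \<in> extensional {..<m}" and v: "\<And>i. i < Suc m \<Longrightarrow> vcons m z y i \<in> A i"
        using p by (auto simp: zy space_pair_measure space_RN PiE_iff)
      have "z \<in> A 0" using v[of 0] by simp
      moreover have "y i \<in> A (Suc i)" if "i < m" for i using v[of "Suc i"] that by simp
      ultimately show "p \<in> A 0 \<times> Pi\<^sub>E {..<m} (\<lambda>i. A (Suc i))"
        using y by (auto simp: zy PiE_iff)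
    next
      fix p assume "p \<in> A 0 \<times> Pi\<^sub>E {..<m} (\<lambda>i. A (Suc i))"
      then obtain z y where zy: "p = (z, y)" "z \<in> A 0" "y \<in> Pi\<^sub>E {..<m} (\<lambda>i. A (Suc i))"
        by auto
      have "vcons m z y i \<in> A i" if "i < Suc m" for i
        using zy that by (cases i) auto
      moreover have "vcons m z y \<in> extensional {..<Suc m}"
        by (simp add: vcons_def)
      ultimately show "p \<in> (\<lambda>(z, y). vcons m z y) -` Pi\<^sub>E {..<Suc m} A \<inter> space (lborel \<Otimes>\<^sub>M RN m)"
        using zy by (auto simp: space_pair_measure space_RN PiE_iff)
    qed
    have "emeasure (distr (lborel \<Otimes>\<^sub>M RN m) (RN (Suc m)) (\<lambda>(z, y). vcons m z y)) (Pi\<^sub>E {..<Suc m} A)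
       = emeasure (lborel \<Otimes>\<^sub>M RN m) (A 0 \<times> Pi\<^sub>E {..<m} (\<lambda>i. A (Suc i)))"
      using S by (subst emeasure_distr) (auto simp: eq)
    also have "\<dots> = emeasure lborel (A 0) * emeasure (RN m) (Pi\<^sub>E {..<m} (\<lambda>i. A (Suc i)))"
      using A[of 0] S' by (subst R.emeasure_pair_measure_Times) auto
    also have "emeasure (RN m) (Pi\<^sub>E {..<m} (\<lambda>i. A (Suc i))) = (\<Prod>i<m. emeasure lborel (A (Suc i)))"
      unfolding RN_def using A by (subst emeasure_PiM) auto
    also have "emeasure lborel (A 0) * \<dots> = (\<Prod>i<Suc m. emeasure lborel (A i))"
      by (simp only: prod.lessThan_Suc_shift)
    finally show "emeasure (distr (lborel \<Otimes>\<^sub>M RN m) (RN (Suc m)) (\<lambda>(z, y). vcons m z y)) (Pi\<^sub>E {..<Suc m} A)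
      = (\<Prod>i<Suc m. emeasure lborel (A i))" .
  qed (auto simp: RN_def)
  then show ?thesis by (simp add: RN_def)
qed

lemma nn_integral_RN_Suc:
  assumes [measurable]: "G \<in> borel_measurable (RN (Suc m))"
  shows "(\<integral>\<^sup>+x. G x \<partial>RN (Suc m)) = (\<integral>\<^sup>+z. \<integral>\<^sup>+y. G (vcons m z y) \<partial>RN m \<partial>lborel)"
proof -
  interpret R: sigma_finite_measure "RN m" by (rule sigma_finite_RN)
  have "(\<integral>\<^sup>+x. G x \<partial>RN (Suc m)) = (\<integral>\<^sup>+p. G (case p of (z, y) \<Rightarrow> vcons m z y) \<partial>(lborel \<Otimes>\<^sub>M RN m))"
    by (subst RN_Suc_eq_distr, subst nn_integral_distr) auto
  also have "\<dots> = (\<integral>\<^sup>+z. \<integral>\<^sup>+y. G (vcons m z y) \<partial>RN m \<partial>lborel)"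
    by (subst R.nn_integral_fst[symmetric]) auto
  finally show ?thesis .
qed

text \<open>Induction on the dimension: each coordinate contributes one factor \<open>c\<close> by
  the affine substitution on the line. In dimension 0 the measure is the unit mass at the empty
  function.\<close>

lemma nn_integral_RN_vscale:
  assumes "0 < c" "G \<in> borel_measurable (RN n)"
  shows "(\<integral>\<^sup>+x. G x \<partial>RN n) = ennreal (c ^ n) * (\<integral>\<^sup>+x. G (vscale n c x) \<partial>RN n)"
  using assms(2)
proof (induction n arbitrary: G)
  case 0
  interpret product_sigma_finite "\<lambda>_::nat. lborel :: real measure"
    by standard
  show ?case
    by (simp add: RN_def PiM_empty nn_integral_count_space_finite vscale_def restrict_def)
next
  case (Suc m)
  interpret R: sigma_finite_measure "RN m" by (rule sigma_finite_RN)
  note [measurable] = Suc.prems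
  have "(\<integral>\<^sup>+x. G x \<partial>RN (Suc m)) = (\<integral>\<^sup>+z. \<integral>\<^sup>+y. G (vcons m z y) \<partial>RN m \<partial>lborel)"
    by (rule nn_integral_RN_Suc) fact
  also have "\<dots> = (\<integral>\<^sup>+z. ennreal (c ^ m) * (\<integral>\<^sup>+y. G (vcons m z (vscale m c y)) \<partial>RN m) \<partial>lborel)"
    by (intro nn_integral_cong Suc.IH) simp
  also have "\<dots> = ennreal \<bar>c\<bar> * (\<integral>\<^sup>+z. ennreal (c ^ m) * (\<integral>\<^sup>+y. G (vcons m (0 + c * z) (vscale m c y)) \<partial>RN m) \<partial>lborel)"
    using assms(1) by (intro nn_integral_real_affine) auto
  also have "\<dots> = ennreal (c ^ Suc m) * (\<integral>\<^sup>+z. (\<integral>\<^sup>+y. G (vcons m (c * z) (vscale m c y)) \<partial>RN m) \<partial>lborel)"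
    using assms(1) by (simp add: nn_integral_cmult ennreal_mult mult.assoc)
  also have "(\<integral>\<^sup>+z. (\<integral>\<^sup>+y. G (vcons m (c * z) (vscale m c y)) \<partial>RN m) \<partial>lborel)
      = (\<integral>\<^sup>+x. G (vscale (Suc m) c x) \<partial>RN (Suc m))"
    by (subst nn_integral_RN_Suc) (auto simp: vscale_vcons)
  finally show ?case .
qed

text \<open>A point whose coordinate at index 0 is nonzero has positive norm, and that coordinate
  vanishes only on a null set. Radial projection divides by the norm; as division by zero yields
  zero, it sends the origin to the origin and not to the sphere, and this lemma discards that
  point.\<close>

lemma AE_RN_enorm_pos:
  assumes "1 \<le> n"
  shows "AE x in RN n. 0 < enorm n x"
proof -
  obtain m where n: "n = Suc m" using assms by (cases n) auto
  interpret R: sigma_finite_measure "RN m" by (rule sigma_finite_RN)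
  have "(\<integral>\<^sup>+x. indicator {x. \<not> 0 < enorm n x} x \<partial>RN n)
      = (\<integral>\<^sup>+z. \<integral>\<^sup>+y. indicator {x. \<not> 0 < enorm n x} (vcons m z y) \<partial>RN m \<partial>lborel)"
    unfolding n by (rule nn_integral_RN_Suc) measurable
  also have "\<dots> = (\<integral>\<^sup>+(z::real). 0 \<partial>lborel)"
  proof (rule nn_integral_cong_AE)
    have "(\<integral>\<^sup>+y. indicator {x. \<not> 0 < enorm n x} (vcons m z y) \<partial>RN m) = (0::ennreal)" if "z \<noteq> 0" for z
    proof -
      have "0 < enorm n (vcons m z y)" for y
        using that by (simp add: n enorm_vcons add_pos_nonneg)
      then show ?thesis by (simp add: indicator_def)
    qed
    then show "AE z in lborel. (\<integral>\<^sup>+y. indicator {x. \<not> 0 < enorm n x} (vcons m z y) \<partial>RN m) = (0::ennreal)"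
      using AE_lborel_singleton[of 0] by (auto elim: eventually_mono)
  qed
  finally have *: "(\<integral>\<^sup>+x. indicator {x. \<not> 0 < enorm n x} x \<partial>RN n) = 0" by simp
  have "AE x in RN n. indicator {x. \<not> 0 < enorm n x} x = (0::ennreal)"
    using * by (subst (asm) nn_integral_0_iff_AE) measurable
  then show ?thesis by (auto simp: indicator_def elim!: eventually_mono split: if_splits)
qed

section \<open>Volumes of balls\<close>

lemma sphere_area_pos: "1 \<le> n \<Longrightarrow> 0 < sphere_area n"
  unfolding sphere_area_def by (intro divide_pos_pos mult_pos_pos Gamma_real_pos) auto

lemma unit_ball_vol_eq_sphere_area:
  assumes "1 \<le> n"
  shows "unit_ball_vol (real n) = sphere_area n / real n"
proof -
  have *: "Gamma (real n / 2 + 1) = real n / 2 * Gamma (real n / 2)"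
    using assms Gamma_plus1[of "real n / 2"] nonpos_Ints_nonpos[of "real n / 2"] by (auto simp: add.commute)
  show ?thesis
    unfolding unit_ball_vol_def sphere_area_def * by (simp add: mult.commute)
qed

lemma emeasure_cball_N:
  assumes "1 \<le> n" "0 < r"
  shows "emeasure (RN n) {x \<in> space (RN n). enorm n x \<le> r} = ennreal (sphere_area n / real n * r ^ n)"
proof -
  have "{x \<in> space (RN n). enorm n x \<le> r}
     = {f. sqrt (\<Sum>i\<in>{..<n}. (f i)\<^sup>2) \<le> r} \<inter> space (Pi\<^sub>M {..<n} (\<lambda>_. lborel))"
    by (auto simp: RN_def enorm_def)
  then show ?thesis
    using emeasure_cball_aux[of "{..<n}" r] assms unit_ball_vol_eq_sphere_area[OF assms(1)]
    by (simp add: RN_def)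
qed

text \<open>The open ball is squeezed: it lies in the closed ball of the same radius and contains
  the closed balls of radius \<open>s < r\<close>, whose volumes tend to the same value as
  \<open>s\<close> tends to \<open>r\<close>.\<close>

lemma emeasure_ball_N:
  assumes "1 \<le> n" "0 < r"
  shows "emeasure (RN n) (ball_N n r) = ennreal (sphere_area n / real n * r ^ n)"
proof (rule antisym)
  have "ball_N n r \<subseteq> {x \<in> space (RN n). enorm n x \<le> r}"
    unfolding ball_N_def space_RN by (rule subsetI) simp
  then show "emeasure (RN n) (ball_N n r) \<le> ennreal (sphere_area n / real n * r ^ n)"
    unfolding emeasure_cball_N[OF assms, symmetric] by (rule emeasure_mono) measurable
  have le: "ennreal (sphere_area n / real n * s ^ n) \<le> emeasure (RN n) (ball_N n r)" if "0 < s" "s < r" for s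
  proof -
    have "{x \<in> space (RN n). enorm n x \<le> s} \<subseteq> ball_N n r"
      unfolding ball_N_def space_RN using that by (intro subsetI) simp
    then show ?thesis
      unfolding emeasure_cball_N[OF assms(1) that(1), symmetric] by (rule emeasure_mono) measurable
  qed
  have lim: "((\<lambda>s. ennreal (sphere_area n / real n * s ^ n)) \<longlongrightarrow> ennreal (sphere_area n / real n * r ^ n)) (at_left r)"
    by (rule tendsto_ennrealI, rule tendsto_mult_left, rule tendsto_power, rule tendsto_ident_at)
  have "\<forall>\<^sub>F s in at_left r. s \<in> {0<..<r}"
    using assms(2) by (rule eventually_at_left_real)
  then have "\<forall>\<^sub>F s in at_left r. ennreal (sphere_area n / real n * s ^ n) \<le> emeasure (RN n) (ball_N n r)"
    by (rule eventually_mono) (rule le, simp_all)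
  then show "ennreal (sphere_area n / real n * r ^ n) \<le> emeasure (RN n) (ball_N n r)"
    by (rule tendsto_upperbound[OF lim]) (rule trivial_limit_at_left_real)
qed

section \<open>The uniform measure on a sphere: integration, support, scaling\<close>

lemma sets_sphere_measure [measurable_cong, simp]: "sets (sphere_measure n r) = sets (RN n)"
  by (simp add: sphere_measure_def)

lemma sphere_measure_eq:
  "sphere_measure n r = distr (uniform_measure (RN n) (ball_N n r)) (RN n)
     (\<lambda>x. vscale n (r / enorm n x) x)"
  by (simp add: sphere_measure_def vscale_def)

lemma emeasure_ball_N_pos_finite:
  assumes "1 \<le> n" "0 < r"
  shows "emeasure (RN n) (ball_N n r) \<noteq> 0" "emeasure (RN n) (ball_N n r) \<noteq> \<infinity>"
  using assms sphere_area_pos[of n] by (simp_all add: emeasure_ball_N)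

lemma prob_space_sphere_measure:
  assumes "1 \<le> n" "0 < r"
  shows "prob_space (sphere_measure n r)"
  unfolding sphere_measure_eq
proof (rule prob_space.prob_space_distr)
  show "prob_space (uniform_measure (RN n) (ball_N n r))"
    using emeasure_ball_N_pos_finite[OF assms] by (intro prob_space_uniform_measure) auto
qed measurable

lemma nn_integral_sphere_measure:
  assumes [measurable]: "G \<in> borel_measurable (RN n)"
  shows "(\<integral>\<^sup>+x. G x \<partial>sphere_measure n r)
    = (\<integral>\<^sup>+x. G (vscale n (r / enorm n x) x) * indicator (ball_N n r) x \<partial>RN n) / emeasure (RN n) (ball_N n r)"
  unfolding sphere_measure_eq
  by (subst nn_integral_distr, measurable, subst nn_integral_uniform_measure) auto

lemma AE_sphere_measure_enorm:
  assumes "1 \<le> n" "0 < r"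
  shows "AE x in sphere_measure n r. enorm n x = r"
  unfolding sphere_measure_eq
proof (subst AE_distr_iff)
  have "AE x in RN n. x \<in> ball_N n r \<longrightarrow> enorm n (vscale n (r / enorm n x) x) = r"
    using AE_RN_enorm_pos[OF assms(1)]
    by eventually_elim (use assms(2) in \<open>auto simp: enorm_vscale\<close>)
  then show "AE x in uniform_measure (RN n) (ball_N n r). enorm n (vscale n (r / enorm n x) x) = r"
    by (intro AE_uniform_measureI) auto
qed measurable

text \<open>Dilation by \<open>r\<close> in the ball integral scales numerator and volume by the
  same \<open>r ^ n\<close>, and radial projection ignores dilations. The radius of a slice varies
  with the coordinate; here all slices become integrals against one fixed measure, so that
  measurability in the radius and Fubini are available.\<close>

lemma nn_integral_sphere_measure_rescale:
  assumes "1 \<le> n" "0 < r" and [measurable]: "G \<in> borel_measurable (RN n)"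
  shows "(\<integral>\<^sup>+x. G x \<partial>sphere_measure n r) = (\<integral>\<^sup>+x. G (vscale n r x) \<partial>sphere_measure n 1)"
proof -
  have ind: "indicator (ball_N n r) (vscale n r x) = (indicator (ball_N n 1) x :: ennreal)"
    if "x \<in> space (RN n)" for x
  proof -
    have "vscale n r x \<in> ball_N n r \<longleftrightarrow> x \<in> ball_N n 1"
      using that assms(2) by (auto simp: ball_N_def enorm_vscale space_RN) (auto simp: vscale_def)
    then show ?thesis by (simp add: indicator_def)
  qed
  have eq: "r / enorm n (vscale n r x) * r = r * (1 / enorm n x)" for x
    using assms(2) by (simp add: enorm_vscale)
  have "(\<integral>\<^sup>+x. G (vscale n (r / enorm n x) x) * indicator (ball_N n r) x \<partial>RN n)
      = ennreal (r ^ n) * (\<integral>\<^sup>+x. G (vscale n (r / enorm n (vscale n r x)) (vscale n r x))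
           * indicator (ball_N n r) (vscale n r x) \<partial>RN n)"
    using assms(2) by (rule nn_integral_RN_vscale) measurable
  also have "\<dots> = ennreal (r ^ n) * (\<integral>\<^sup>+x. G (vscale n r (vscale n (1 / enorm n x) x)) * indicator (ball_N n 1) x \<partial>RN n)"
    by (intro arg_cong[where f="\<lambda>x. ennreal (r ^ n) * x"] nn_integral_cong)
       (simp only: ind vscale_vscale eq)
  finally have *: "(\<integral>\<^sup>+x. G (vscale n (r / enorm n x) x) * indicator (ball_N n r) x \<partial>RN n) = \<dots>" .
  have em: "emeasure (RN n) (ball_N n r) = ennreal (r ^ n) * emeasure (RN n) (ball_N n 1)"
    using assms(1,2) sphere_area_pos[of n]
    by (simp add: emeasure_ball_N ennreal_mult[symmetric] mult.commute)
  show ?thesis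
    unfolding nn_integral_sphere_measure[OF assms(3)]
    apply (subst nn_integral_sphere_measure, measurable)
    apply (simp only: * em)
    using assms(2) by (simp add: divide_mult_eq mult.commute[of "ennreal (r ^ n)"])
qed

subsection \<open>Polar coordinates\<close>

text \<open>Fubini is applied below to indicators of half-lines whose end point depends on the other
  variable; this rule makes their joint measurability automatic.\<close>

lemma pred_greaterThan [measurable (raw)]:
  fixes f g :: "'a \<Rightarrow> real"
  assumes [measurable]: "f \<in> borel_measurable M" "g \<in> borel_measurable M"
  shows "Measurable.pred M (\<lambda>x. g x \<in> {f x<..})"
  unfolding greaterThan_iff by measurable

text \<open>The integrand, a Pareto density, is the derivative of \<open>- ((a / s) ^ m)\<close>,
  which rises from -1 at \<open>a\<close> to 0 at infinity. In polar coordinates it integrates out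
  the auxiliary dilation \<open>s\<close>.\<close>

lemma nn_integral_power_tail:
  assumes "1 \<le> m" "0 < a"
  shows "(\<integral>\<^sup>+s. ennreal (real m * a ^ m / s ^ Suc m) * indicator {a<..} s \<partial>lborel) = 1"
proof -
  have lim: "((\<lambda>s. - ((a / s) ^ m)) \<longlongrightarrow> - (0 ^ m)) at_top"
    by (intro tendsto_minus tendsto_power real_tendsto_divide_at_top[OF tendsto_const] filterlim_ident)
  have deriv: "((\<lambda>s. - ((a / s) ^ m)) has_real_derivative (real m * a ^ m / s ^ Suc m)) (at s)" if "a \<le> s" for s
  proof -
    have s: "0 < s" using that assms(2) by simp
    obtain k where m: "m = Suc k" using assms(1) by (cases m) auto
    have "((\<lambda>s. a / s) has_real_derivative (- a / (s * s))) (at s)"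
      using s by (auto intro!: derivative_eq_intros)
    then have "((\<lambda>s. - ((a / s) ^ m)) has_real_derivative - (real m * ((- a / (s * s)) * (a / s) ^ (m - Suc 0)))) (at s)"
      by (intro DERIV_minus DERIV_power)
    moreover have "- (real m * ((- a / (s * s)) * (a / s) ^ (m - Suc 0))) = real m * a ^ m / s ^ Suc m"
      using s by (simp add: m power_divide field_simps)
    ultimately show ?thesis by simp
  qed
  have "(\<integral>\<^sup>+s. ennreal (real m * a ^ m / s ^ Suc m) * indicator {a<..} s \<partial>lborel)
      = (\<integral>\<^sup>+s. ennreal (real m * a ^ m / s ^ Suc m) * indicator {a..} s \<partial>lborel)"
    by (rule nn_integral_cong_AE, rule eventually_mono[OF AE_lborel_singleton[of a]])
       (auto simp: indicator_def)
  also have "\<dots> = ennreal (- (0 ^ m) - - ((a / a) ^ m))"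
    using assms by (intro nn_integral_FTC_atLeast deriv lim) auto
  also have "\<dots> = 1" using assms by simp
  finally show ?thesis .
qed

text \<open>The right-hand side, written as an integral over the unit ball, is turned into the left-hand
  side by the substitutions \<open>t = s |x|\<close> and \<open>y = s x\<close> alone.\<close>

lemma nn_integral_polar:
  assumes m: "1 \<le> m" and [measurable]: "\<Psi> \<in> borel_measurable (RN m)"
  shows "(\<integral>\<^sup>+y. \<Psi> y \<partial>RN m) = ennreal (sphere_area m) *
    (\<integral>\<^sup>+t. ennreal (t ^ (m - 1)) * indicator {0<..} t * (\<integral>\<^sup>+\<eta>. \<Psi> (vscale m t \<eta>) \<partial>sphere_measure m 1) \<partial>lborel)"
proof -
  interpret R: sigma_finite_measure "RN m" by (rule sigma_finite_RN)
  interpret P: pair_sigma_finite "lborel :: real measure" "RN m" by standard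
  define V where "V = sphere_area m / real m"
  have V: "0 < V" using sphere_area_pos[OF m] m by (simp add: V_def)
  have em: "emeasure (RN m) (ball_N m 1) = ennreal V"
    using emeasure_ball_N[of m 1] m by (simp add: V_def)
  define w where "w t = ennreal (t ^ (m - 1)) * indicator {0<..} t" for t :: real
  have [measurable]: "w \<in> borel_measurable borel" unfolding w_def by measurable
  have pw: "a * a ^ (m - 1) = a ^ m" for a :: real
    using m by (cases m) auto
  have "(\<integral>\<^sup>+t. w t * (\<integral>\<^sup>+\<eta>. \<Psi> (vscale m t \<eta>) \<partial>sphere_measure m 1) \<partial>lborel)
     = (\<integral>\<^sup>+t. w t * ((\<integral>\<^sup>+x. \<Psi> (vscale m (t / enorm m x) x) * indicator (ball_N m 1) x \<partial>RN m) / ennreal V) \<partial>lborel)"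
    by (subst nn_integral_sphere_measure) (auto simp: em)
  also have "\<dots> = (\<integral>\<^sup>+t. (\<integral>\<^sup>+x. w t * \<Psi> (vscale m (t / enorm m x) x) * indicator (ball_N m 1) x \<partial>RN m) \<partial>lborel) / ennreal V"
    by (subst nn_integral_divide[symmetric], measurable, intro nn_integral_cong)
       (simp add: ennreal_times_divide nn_integral_cmult[symmetric] mult.assoc)
  also have "(\<integral>\<^sup>+t. (\<integral>\<^sup>+x. w t * \<Psi> (vscale m (t / enorm m x) x) * indicator (ball_N m 1) x \<partial>RN m) \<partial>lborel)
     = (\<integral>\<^sup>+x. (\<integral>\<^sup>+t. w t * \<Psi> (vscale m (t / enorm m x) x) * indicator (ball_N m 1) x \<partial>lborel) \<partial>RN m)"
    by (rule P.Fubini'[symmetric]) measurable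
  \<comment> \<open>For fixed \<open>x\<close> put \<open>t = s * enorm m x\<close>: the weight
    \<open>w\<close> is homogeneous of degree \<open>m - 1\<close>, and the differential adds one
    more factor of the norm.\<close>
  also have "\<dots> = (\<integral>\<^sup>+x. (\<integral>\<^sup>+s. w s * ennreal (enorm m x ^ m) * \<Psi> (vscale m s x) * indicator (ball_N m 1) x \<partial>lborel) \<partial>RN m)"
  proof (rule nn_integral_cong_AE, rule AE_mp[OF AE_RN_enorm_pos[OF m] AE_I2], intro impI)
    fix x assume "x \<in> space (RN m)" and x: "0 < enorm m x"
    then have "(\<lambda>t. vscale m t x) \<in> measurable borel (RN m)"
      by (intro vscale_measurable measurable_const) simp_all
    then have \<phi>_meas: "(\<lambda>t. \<Psi> (vscale m t x)) \<in> borel_measurable borel"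
      by (rule measurable_compose) fact
    define \<phi> where "\<phi> t = \<Psi> (vscale m t x)" for t
    have [measurable]: "\<phi> \<in> borel_measurable borel"
      using \<phi>_meas by (simp add: \<phi>_def[abs_def])
    have ws: "ennreal (enorm m x) * w (enorm m x * s) = w s * ennreal (enorm m x ^ m)" for s
    proof (cases "0 < s")
      case True
      then show ?thesis
        using x pw[of "enorm m x"] by (simp add: w_def ennreal_mult[symmetric] power_mult_distrib mult_ac)
    next
      case False
      then show ?thesis using x by (simp add: w_def indicator_def zero_less_mult_iff)
    qed
    have "(\<integral>\<^sup>+t. w t * \<phi> (t / enorm m x) * indicator (ball_N m 1) x \<partial>lborel)
      = ennreal \<bar>enorm m x\<bar> * (\<integral>\<^sup>+s. w (0 + enorm m x * s) * \<phi> ((0 + enorm m x * s) / enorm m x) * indicator (ball_N m 1) x \<partial>lborel)"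
      using x by (intro nn_integral_real_affine) auto
    also have "\<dots> = (\<integral>\<^sup>+s. ennreal (enorm m x) * (w (enorm m x * s) * \<phi> s * indicator (ball_N m 1) x) \<partial>lborel)"
      using x by (subst nn_integral_cmult) auto
    also have "\<dots> = (\<integral>\<^sup>+s. w s * ennreal (enorm m x ^ m) * \<phi> s * indicator (ball_N m 1) x \<partial>lborel)"
      by (simp add: ws[symmetric] mult.assoc)
    finally show "(\<integral>\<^sup>+t. w t * \<Psi> (vscale m (t / enorm m x) x) * indicator (ball_N m 1) x \<partial>lborel)
      = (\<integral>\<^sup>+s. w s * ennreal (enorm m x ^ m) * \<Psi> (vscale m s x) * indicator (ball_N m 1) x \<partial>lborel)"
      unfolding \<phi>_def .
  qed
  also have "\<dots> = (\<integral>\<^sup>+s. (\<integral>\<^sup>+x. w s * ennreal (enorm m x ^ m) * \<Psi> (vscale m s x) * indicator (ball_N m 1) x \<partial>RN m) \<partial>lborel)"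
    by (rule P.Fubini') measurable
  \<comment> \<open>For fixed \<open>s\<close> the substitution by the dilation has Jacobian
    \<open>s ^ m\<close>. The unit ball turns into the condition that \<open>s\<close> exceeds the
    norm of \<open>y\<close>, and the powers of \<open>s\<close> combine to
    \<open>1 / s ^ Suc m\<close>.\<close>
  also have "\<dots> = (\<integral>\<^sup>+s. (\<integral>\<^sup>+y. ennreal (enorm m y ^ m / s ^ Suc m) * \<Psi> y * indicator {enorm m y<..} s \<partial>RN m) \<partial>lborel)"
  proof (rule nn_integral_cong_AE, rule eventually_mono[OF AE_lborel_singleton[of "0::real"]])
    fix s :: real assume "s \<noteq> 0"
    show "(\<integral>\<^sup>+x. w s * ennreal (enorm m x ^ m) * \<Psi> (vscale m s x) * indicator (ball_N m 1) x \<partial>RN m)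
      = (\<integral>\<^sup>+y. ennreal (enorm m y ^ m / s ^ Suc m) * \<Psi> y * indicator {enorm m y<..} s \<partial>RN m)"
    proof (cases "0 < s")
      case False
      then have "w s = 0" "\<And>y. indicator {enorm m y<..} s = (0::ennreal)"
        using enorm_nonneg[of m] by (auto simp: w_def indicator_def not_less intro: order_trans)
      then show ?thesis by simp
    next
      case s: True
      have "(\<integral>\<^sup>+y. ennreal (enorm m y ^ m / s ^ Suc m) * \<Psi> y * indicator {enorm m y<..} s \<partial>RN m)
        = ennreal (s ^ m) * (\<integral>\<^sup>+x. ennreal (enorm m (vscale m s x) ^ m / s ^ Suc m) * \<Psi> (vscale m s x)
            * indicator {enorm m (vscale m s x)<..} s \<partial>RN m)"
        using s by (rule nn_integral_RN_vscale) measurable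
      also have "\<dots> = (\<integral>\<^sup>+x. w s * ennreal (enorm m x ^ m) * \<Psi> (vscale m s x) * indicator (ball_N m 1) x \<partial>RN m)"
      proof (subst nn_integral_cmult[symmetric], measurable, rule nn_integral_cong)
        fix x assume x: "x \<in> space (RN m)"
        have i: "indicator {enorm m (vscale m s x)<..} s = (indicator (ball_N m 1) x :: ennreal)"
          using x s by (simp add: indicator_def ball_N_def enorm_vscale space_RN)
        have "s ^ m * (enorm m (vscale m s x) ^ m / s ^ Suc m) = s ^ (m - 1) * enorm m x ^ m"
          using s pw[of s, symmetric] by (simp add: enorm_vscale power_mult_distrib)
        then have "ennreal (s ^ m) * ennreal (enorm m (vscale m s x) ^ m / s ^ Suc m) = w s * ennreal (enorm m x ^ m)"
          using s by (simp add: w_def ennreal_mult[symmetric])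
        then show "ennreal (s ^ m) * (ennreal (enorm m (vscale m s x) ^ m / s ^ Suc m) * \<Psi> (vscale m s x)
            * indicator {enorm m (vscale m s x)<..} s)
          = w s * ennreal (enorm m x ^ m) * \<Psi> (vscale m s x) * indicator (ball_N m 1) x"
          by (simp only: i mult.assoc[symmetric])
      qed
      finally show ?thesis by simp
    qed
  qed
  also have "\<dots> = (\<integral>\<^sup>+y. (\<integral>\<^sup>+s. ennreal (enorm m y ^ m / s ^ Suc m) * \<Psi> y * indicator {enorm m y<..} s \<partial>lborel) \<partial>RN m)"
    by (rule P.Fubini'[symmetric]) measurable
  also have "\<dots> = (\<integral>\<^sup>+y. \<Psi> y * ennreal (1 / real m) \<partial>RN m)"
  proof (rule nn_integral_cong_AE, rule eventually_mono[OF AE_RN_enorm_pos[OF m]])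
    fix y assume y: "0 < enorm m y"
    have "(\<integral>\<^sup>+s. ennreal (enorm m y ^ m / s ^ Suc m) * \<Psi> y * indicator {enorm m y<..} s \<partial>lborel)
      = (\<integral>\<^sup>+s. (\<Psi> y * ennreal (1 / real m)) * (ennreal (real m * enorm m y ^ m / s ^ Suc m) * indicator {enorm m y<..} s) \<partial>lborel)"
    proof (rule nn_integral_cong)
      fix s :: real
      show "ennreal (enorm m y ^ m / s ^ Suc m) * \<Psi> y * indicator {enorm m y<..} s
        = (\<Psi> y * ennreal (1 / real m)) * (ennreal (real m * enorm m y ^ m / s ^ Suc m) * indicator {enorm m y<..} s)"
      proof (cases "enorm m y < s")
        case True
        then have "0 < s" using y by simp
        then have "ennreal (1 / real m) * ennreal (real m * enorm m y ^ m / s ^ Suc m) = ennreal (enorm m y ^ m / s ^ Suc m)"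
          using m y by (simp add: ennreal_mult[symmetric])
        then show ?thesis by (metis mult.assoc mult.commute)
      qed (simp add: indicator_def)
    qed
    also have "\<dots> = \<Psi> y * ennreal (1 / real m)"
      by (subst nn_integral_cmult, measurable, subst nn_integral_power_tail[OF m y]) simp
    finally show "(\<integral>\<^sup>+s. ennreal (enorm m y ^ m / s ^ Suc m) * \<Psi> y * indicator {enorm m y<..} s \<partial>lborel) = \<dots>" .
  qed
  also have "\<dots> = (\<integral>\<^sup>+y. \<Psi> y \<partial>RN m) * ennreal (1 / real m)"
    by (rule nn_integral_multc) measurable
  finally have "ennreal (sphere_area m) * (\<integral>\<^sup>+t. w t * (\<integral>\<^sup>+\<eta>. \<Psi> (vscale m t \<eta>) \<partial>sphere_measure m 1) \<partial>lborel)
    = ennreal (sphere_area m) * ((\<integral>\<^sup>+y. \<Psi> y \<partial>RN m) * ennreal (1 / real m) / ennreal V)"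
    by simp
  also have "\<dots> = (\<integral>\<^sup>+y. \<Psi> y \<partial>RN m) * (ennreal (sphere_area m) * ennreal (1 / real m) / ennreal V)"
    by (simp add: ennreal_times_divide mult_ac)
  also have "ennreal (sphere_area m) * ennreal (1 / real m) / ennreal V = 1"
    using sphere_area_pos[OF m] m V by (simp add: ennreal_mult[symmetric] V_def[symmetric] divide_ennreal)
  finally show ?thesis
    by (simp add: w_def)
qed

subsection \<open>Slicing the sphere\<close>

text \<open>Central projection \<open>q = z / sqrt (R^2 - z^2)\<close>: the ratio of a coordinate on
  the sphere to the radius of its slice. As \<open>h\<close> is only measurable, the change of
  variables is proved for measures: the push forward of the density agrees with Lebesgue measure on
  intervals.\<close>

lemma nn_integral_gnomonic:
  fixes R :: real
  assumes R: "0 < R" and [measurable]: "h \<in> borel_measurable borel"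
  shows "(\<integral>\<^sup>+q. h q \<partial>lborel) = (\<integral>\<^sup>+z. ennreal (R\<^sup>2 / sqrt (R\<^sup>2 - z\<^sup>2) ^ 3) * indicator {-R<..<R} z
     * h (z / sqrt (R\<^sup>2 - z\<^sup>2)) \<partial>lborel)"
proof -
  define \<gamma> where "\<gamma> z = z / sqrt (R\<^sup>2 - z\<^sup>2)" for z
  \<comment> \<open>The inverse of \<open>\<gamma>\<close>, from the whole line onto the open
    interval between \<open>-R\<close> and \<open>R\<close>.\<close>
  define \<tau> where "\<tau> u = R * u / sqrt (1 + u\<^sup>2)" for u
  define d where "d z = R\<^sup>2 / sqrt (R\<^sup>2 - z\<^sup>2) ^ 3" for z
  have [measurable]: "\<gamma> \<in> borel_measurable borel" "d \<in> borel_measurable borel"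
    unfolding \<gamma>_def d_def by measurable
  have pos: "0 < R\<^sup>2 - z\<^sup>2" if "z \<in> {-R<..<R}" for z
    using that abs_square_less_1[of "z / R"] R by (simp add: power_divide abs_less_iff field_simps)
  have deriv: "(\<gamma> has_real_derivative d z) (at z)" if z: "z \<in> {-R<..<R}" for z
  proof -
    define s where "s = sqrt (R\<^sup>2 - z\<^sup>2)"
    have s: "0 < s" and s2: "s * s = R\<^sup>2 - z\<^sup>2" using pos[OF z] by (simp_all add: s_def)
    have "((\<lambda>z. z / sqrt (R\<^sup>2 - z\<^sup>2)) has_real_derivative
        (1 * sqrt (R\<^sup>2 - z\<^sup>2) - z * ((0 - 2 * z) * (inverse (sqrt (R\<^sup>2 - z\<^sup>2)) / 2))) / (sqrt (R\<^sup>2 - z\<^sup>2) * sqrt (R\<^sup>2 - z\<^sup>2))) (at z)"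
      using pos[OF z] s unfolding s_def by (auto intro!: derivative_eq_intros)
    moreover have "(1 * s - z * ((0 - 2 * z) * (inverse s / 2))) / (s * s) = R\<^sup>2 / s ^ 3"
    proof -
      have "(1 * s - z * ((0 - 2 * z) * (inverse s / 2))) / (s * s) = (s * s + z * z) / (s * s * s)"
        using s by (simp add: field_simps)
      also have "\<dots> = R\<^sup>2 / s ^ 3"
        by (simp add: s2 power2_eq_square power3_eq_cube)
      finally show ?thesis .
    qed
    ultimately show ?thesis unfolding d_def s_def \<gamma>_def[abs_def] by simp
  qed
  have d_pos: "0 < d z" if "z \<in> {-R<..<R}" for z
    using pos[OF that] R by (simp add: d_def)
  have mono: "\<gamma> x < \<gamma> y" if "x < y" "x \<in> {-R<..<R}" "y \<in> {-R<..<R}" for x y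
    using that by (intro DERIV_pos_imp_increasing[of x y \<gamma>]) (auto intro!: exI[of _ "d _"] deriv d_pos)
  have \<tau>_range: "\<tau> u \<in> {-R<..<R}" and \<gamma>_\<tau>: "\<gamma> (\<tau> u) = u" for u
  proof -
    define k where "k = sqrt (1 + u\<^sup>2)"
    have k: "0 < k" "k\<^sup>2 = 1 + u\<^sup>2" by (simp_all add: k_def add_pos_nonneg)
    then have u2: "u\<^sup>2 = k\<^sup>2 - 1" by simp
    have "\<bar>u\<bar> < k" unfolding k_def by (simp add: real_less_rsqrt)
    then show "\<tau> u \<in> {-R<..<R}"
      using R k(1) mult_strict_left_mono[of "-k" u R]
      by (simp add: \<tau>_def k_def[symmetric] abs_less_iff field_simps)
    have "R\<^sup>2 - (\<tau> u)\<^sup>2 = (R / k)\<^sup>2"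
      using k(1) by (simp add: \<tau>_def k_def[symmetric] power_divide power_mult_distrib u2 field_simps)
    then have "sqrt (R\<^sup>2 - (\<tau> u)\<^sup>2) = R / k" using R k(1) by simp
    then show "\<gamma> (\<tau> u) = u"
      using R k(1) by (simp add: \<gamma>_def \<tau>_def k_def[symmetric])
  qed
  have less_iff: "\<gamma> z < u \<longleftrightarrow> z < \<tau> u" "u < \<gamma> z \<longleftrightarrow> \<tau> u < z" if "z \<in> {-R<..<R}" for z u
    using mono[of z "\<tau> u"] mono[of "\<tau> u" z] that \<tau>_range[of u] \<gamma>_\<tau>[of u]
    by (metis less_asym linorder_less_linear)+
  have eq: "lborel = distr (density lborel (\<lambda>z. ennreal (d z) * indicator {-R<..<R} z)) borel \<gamma>"
  proof (rule lborel_eqI)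
    fix l u :: real assume "\<And>b. b \<in> Basis \<Longrightarrow> l \<bullet> b \<le> u \<bullet> b"
    then have lu: "l \<le> u" by simp
    have \<tau>_lu: "\<tau> l \<le> \<tau> u"
      using less_iff(1)[OF \<tau>_range[of u], of l] lu \<gamma>_\<tau>[of u] by (simp add: not_less[symmetric])
    have vim: "\<gamma> -` {l<..<u} \<in> sets borel"
      using measurable_sets[of \<gamma> borel borel "{l<..<u}"] by simp
    have "emeasure (distr (density lborel (\<lambda>z. ennreal (d z) * indicator {-R<..<R} z)) borel \<gamma>) (box l u)
      = (\<integral>\<^sup>+z. ennreal (d z) * indicator {-R<..<R} z * indicator (\<gamma> -` {l<..<u}) z \<partial>lborel)"
      by (subst emeasure_distr, measurable, subst emeasure_density)
         (use vim in \<open>auto simp: box_real\<close>)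
    \<comment> \<open>Since \<open>\<gamma>\<close> increases, the preimage of
      \<open>{l<..<u}\<close> is, up to end points, the interval from \<open>\<tau> l\<close> to
      \<open>\<tau> u\<close>; as \<open>d\<close> is the derivative of \<open>\<gamma>\<close>, the
      integral is \<open>u - l\<close>.\<close>
    also have "\<dots> = (\<integral>\<^sup>+z. ennreal (d z) * indicator {\<tau> l..\<tau> u} z \<partial>lborel)"
    proof (rule nn_integral_cong_AE)
      show "AE z in lborel. ennreal (d z) * indicator {-R<..<R} z * indicator (\<gamma> -` {l<..<u}) z
          = ennreal (d z) * indicator {\<tau> l..\<tau> u} z"
        using AE_lborel_singleton[of "\<tau> l"] AE_lborel_singleton[of "\<tau> u"]
      proof eventually_elim
        fix z assume "z \<noteq> \<tau> l" "z \<noteq> \<tau> u"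
        then have "z \<in> {-R<..<R} \<and> \<gamma> z \<in> {l<..<u} \<longleftrightarrow> z \<in> {\<tau> l..\<tau> u}"
          using less_iff[of z] \<tau>_range[of l] \<tau>_range[of u] by force
        then show "ennreal (d z) * indicator {-R<..<R} z * indicator (\<gamma> -` {l<..<u}) z
          = ennreal (d z) * indicator {\<tau> l..\<tau> u} z"
          by (auto simp: indicator_def)
      qed
    qed
    also have "\<dots> = ennreal (\<gamma> (\<tau> u) - \<gamma> (\<tau> l))"
    proof (rule nn_integral_FTC_Icc)
      fix z assume "z \<in> {\<tau> l..\<tau> u}"
      then have z: "z \<in> {-R<..<R}" using \<tau>_range[of l] \<tau>_range[of u] by auto
      show "(\<gamma> has_real_derivative d z) (at z)" using z by (rule deriv)
      show "0 \<le> d z" using d_pos[OF z] by simp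
    qed (use \<tau>_lu in auto)
    finally show "emeasure (distr (density lborel (\<lambda>z. ennreal (d z) * indicator {-R<..<R} z)) borel \<gamma>) (box l u)
      = ennreal (\<Prod>b\<in>Basis. (u - l) \<bullet> b)"
      by (simp add: \<gamma>_\<tau>)
  qed simp
  show ?thesis
    by (subst eq, subst nn_integral_distr, measurable, subst nn_integral_density)
       (auto simp: \<gamma>_def d_def)
qed

lemma nn_integral_power_interval:
  assumes "0 \<le> (b::real)"
  shows "(\<integral>\<^sup>+t. ennreal (t ^ m) * indicator {0<..<b} t \<partial>lborel) = ennreal (b ^ Suc m / real (Suc m))"
proof -
  have "(\<integral>\<^sup>+t. ennreal (t ^ m) * indicator {0<..<b} t \<partial>lborel) = (\<integral>\<^sup>+t. ennreal (t ^ m) * indicator {0..b} t \<partial>lborel)"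
  proof (rule nn_integral_cong_AE)
    show "AE t in lborel. ennreal (t ^ m) * indicator {0<..<b} t = ennreal (t ^ m) * indicator {0..b} t"
      using AE_lborel_singleton[of 0] AE_lborel_singleton[of b]
      by eventually_elim (auto simp: indicator_def)
  qed
  also have "\<dots> = ennreal (b ^ Suc m / real (Suc m) - 0 ^ Suc m / real (Suc m))"
    using assms by (intro nn_integral_FTC_Icc)
      (auto intro!: derivative_eq_intros simp del: power_Suc)
  finally show ?thesis by simp
qed

text \<open>\<open>K\<close> extends \<open>G\<close> to the ball, constantly along rays. Write the
  first coordinate in the ball as \<open>t * q\<close>, where \<open>t\<close> is the norm of the
  remaining ones: the ray depends on \<open>q\<close> and a direction alone, so the integral over
  \<open>t\<close> is that of \<open>t ^ m\<close> up to the boundary of the ball. Central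
  projection then replaces the slope \<open>q\<close> by the coordinate \<open>z\<close> on the
  sphere. The density has the form \<open>sqrt (R^2 - z^2) ^ m / (R^2 - z^2)\<close> because the
  exponent \<open>m - 2\<close> is negative for \<open>m = 1\<close>.\<close>

lemma nn_integral_sphere_slice:
  assumes m: "1 \<le> m" and R: "0 < R" and G[measurable]: "G \<in> borel_measurable (RN (Suc m))"
  shows "(\<integral>\<^sup>+x. G x \<partial>sphere_measure (Suc m) R) = ennreal (sphere_area m / sphere_area (Suc m)) *
    (\<integral>\<^sup>+z. ennreal (sqrt (R\<^sup>2 - z\<^sup>2) ^ m / (R\<^sup>2 - z\<^sup>2) * (R / R ^ m)) * indicator {-R<..<R} z *
       (\<integral>\<^sup>+y. G (vcons m z y) \<partial>sphere_measure m (sqrt (R\<^sup>2 - z\<^sup>2))) \<partial>lborel)"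
proof -
  interpret R: sigma_finite_measure "RN m" by (rule sigma_finite_RN)
  interpret S: prob_space "sphere_measure m 1" using m by (intro prob_space_sphere_measure) auto
  define K where "K x = G (vscale (Suc m) (R / enorm (Suc m) x) x) * indicator (ball_N (Suc m) R) x" for x
  have [measurable]: "K \<in> borel_measurable (RN (Suc m))" unfolding K_def by measurable
  define w where "w t = ennreal (t ^ (m - 1)) * indicator {0<..} t" for t :: real
  have [measurable]: "w \<in> borel_measurable borel" unfolding w_def by measurable
  define \<kappa> where "\<kappa> x t = (\<integral>\<^sup>+\<eta>. K (vcons m x (vscale m t \<eta>)) \<partial>sphere_measure m 1)" for x t
  have [measurable]: "case_prod \<kappa> \<in> borel_measurable (borel \<Otimes>\<^sub>M borel)" unfolding \<kappa>_def by measurable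
  define \<Gamma> where "\<Gamma> q = (\<integral>\<^sup>+\<eta>. G (vscale (Suc m) (R / sqrt (1 + q\<^sup>2)) (vcons m q \<eta>)) \<partial>sphere_measure m 1)" for q
  have [measurable]: "\<Gamma> \<in> borel_measurable borel" unfolding \<Gamma>_def by measurable
  define J where "J z = (\<integral>\<^sup>+\<eta>. G (vcons m z (vscale m (sqrt (R\<^sup>2 - z\<^sup>2)) \<eta>)) \<partial>sphere_measure m 1)" for z
  have [measurable]: "J \<in> borel_measurable borel" unfolding J_def by measurable
  have pos: "0 < R\<^sup>2 - z\<^sup>2" if "z \<in> {-R<..<R}" for z
    using that abs_square_less_1[of "z / R"] R by (simp add: power_divide abs_less_iff field_simps)
  \<comment> \<open>For \<open>\<eta>\<close> of norm 1 the dilated point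
    \<open>t * (q, \<eta>)\<close> has norm \<open>t * sqrt (1 + q^2)\<close>, which places the
    cut-off; its projection to the sphere does not involve \<open>t\<close>.\<close>
  have \<kappa>_scaled: "\<kappa> (t * q) t = \<Gamma> q * indicator {..<R / sqrt (1 + q\<^sup>2)} t" if t: "0 < t" for t q
  proof -
    have "\<kappa> (t * q) t = (\<integral>\<^sup>+\<eta>. G (vscale (Suc m) (R / sqrt (1 + q\<^sup>2)) (vcons m q \<eta>)) * indicator {..<R / sqrt (1 + q\<^sup>2)} t \<partial>sphere_measure m 1)"
      unfolding \<kappa>_def
    proof (rule nn_integral_cong_AE, rule eventually_mono[OF AE_sphere_measure_enorm[OF m zero_less_one]])
      fix \<eta> assume "enorm m \<eta> = 1"
      then have e: "enorm (Suc m) (vcons m q \<eta>) = sqrt (1 + q\<^sup>2)"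
        by (simp add: enorm_vcons add.commute)
      have p: "0 < sqrt (1 + q\<^sup>2)" by (simp add: add_pos_nonneg)
      have "vscale (Suc m) t (vcons m q \<eta>) \<in> ball_N (Suc m) R \<longleftrightarrow> t < R / sqrt (1 + q\<^sup>2)"
        using t p by (simp add: ball_N_def enorm_vscale e field_simps) (simp add: vscale_def PiE_iff)
      then show "K (vcons m (t * q) (vscale m t \<eta>)) = G (vscale (Suc m) (R / sqrt (1 + q\<^sup>2)) (vcons m q \<eta>)) * indicator {..<R / sqrt (1 + q\<^sup>2)} t"
        using t unfolding K_def vscale_vcons[symmetric] by (simp add: enorm_vscale e indicator_def)
    qed
    also have "\<dots> = \<Gamma> q * indicator {..<R / sqrt (1 + q\<^sup>2)} t"
      unfolding \<Gamma>_def by (rule nn_integral_multc) measurable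
    finally show ?thesis .
  qed
  have "(\<integral>\<^sup>+x. K x \<partial>RN (Suc m)) = (\<integral>\<^sup>+x. \<integral>\<^sup>+y. K (vcons m x y) \<partial>RN m \<partial>lborel)"
    by (rule nn_integral_RN_Suc) measurable
  also have "\<dots> = (\<integral>\<^sup>+x. ennreal (sphere_area m) * (\<integral>\<^sup>+t. w t * \<kappa> x t \<partial>lborel) \<partial>lborel)"
    unfolding w_def \<kappa>_def by (intro nn_integral_cong nn_integral_polar[OF m]) measurable
  also have "\<dots> = ennreal (sphere_area m) * (\<integral>\<^sup>+x. (\<integral>\<^sup>+t. w t * \<kappa> x t \<partial>lborel) \<partial>lborel)"
    by (rule nn_integral_cmult) measurable
  also have "(\<integral>\<^sup>+x. (\<integral>\<^sup>+t. w t * \<kappa> x t \<partial>lborel) \<partial>lborel) = (\<integral>\<^sup>+t. (\<integral>\<^sup>+x. w t * \<kappa> x t \<partial>lborel) \<partial>lborel)"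
    by (rule lborel_pair.Fubini') measurable
  also have "\<dots> = (\<integral>\<^sup>+t. (\<integral>\<^sup>+q. \<Gamma> q * (ennreal (t ^ m) * indicator {0<..<R / sqrt (1 + q\<^sup>2)} t) \<partial>lborel) \<partial>lborel)"
  proof (rule nn_integral_cong)
    fix t :: real
    show "(\<integral>\<^sup>+x. w t * \<kappa> x t \<partial>lborel) = (\<integral>\<^sup>+q. \<Gamma> q * (ennreal (t ^ m) * indicator {0<..<R / sqrt (1 + q\<^sup>2)} t) \<partial>lborel)"
    proof (cases "0 < t")
      case False
      then show ?thesis by (simp add: w_def indicator_def)
    next
      case t: True
      \<comment> \<open>The Jacobian of \<open>x = t * q\<close> raises the polar weight from
        \<open>t ^ (m - 1)\<close> to \<open>t ^ m\<close>.\<close>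
      have tw: "ennreal t * w t = ennreal (t ^ m)"
        using t m by (cases m) (simp_all add: w_def ennreal_mult[symmetric])
      have "(\<integral>\<^sup>+x. w t * \<kappa> x t \<partial>lborel) = ennreal \<bar>t\<bar> * (\<integral>\<^sup>+q. w t * \<kappa> (0 + t * q) t \<partial>lborel)"
        using t by (intro nn_integral_real_affine) auto
      also have "\<dots> = (\<integral>\<^sup>+q. (ennreal t * w t) * \<kappa> (t * q) t \<partial>lborel)"
        using t by (subst nn_integral_cmult[symmetric]) (auto simp: mult.assoc)
      also have "\<dots> = (\<integral>\<^sup>+q. \<Gamma> q * (ennreal (t ^ m) * indicator {0<..<R / sqrt (1 + q\<^sup>2)} t) \<partial>lborel)"
        using t unfolding tw \<kappa>_scaled[OF t] by (intro nn_integral_cong) (simp add: indicator_def mult.commute)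
      finally show ?thesis .
    qed
  qed
  also have "\<dots> = (\<integral>\<^sup>+q. (\<integral>\<^sup>+t. \<Gamma> q * (ennreal (t ^ m) * indicator {0<..<R / sqrt (1 + q\<^sup>2)} t) \<partial>lborel) \<partial>lborel)"
    unfolding greaterThanLessThan_def by (rule lborel_pair.Fubini') (measurable, simp)
  also have "\<dots> = (\<integral>\<^sup>+q. \<Gamma> q * ennreal ((R / sqrt (1 + q\<^sup>2)) ^ Suc m / real (Suc m)) \<partial>lborel)"
    using R by (subst nn_integral_cmult) (simp_all add: nn_integral_power_interval del: power_Suc of_nat_Suc)
  also have "\<dots> = (\<integral>\<^sup>+z. ennreal (R\<^sup>2 / sqrt (R\<^sup>2 - z\<^sup>2) ^ 3) * indicator {-R<..<R} z
     * (\<Gamma> (z / sqrt (R\<^sup>2 - z\<^sup>2)) * ennreal ((R / sqrt (1 + (z / sqrt (R\<^sup>2 - z\<^sup>2))\<^sup>2)) ^ Suc m / real (Suc m))) \<partial>lborel)"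
    by (rule nn_integral_gnomonic[OF R]) measurable
  also have "\<dots> = (\<integral>\<^sup>+z. ennreal (R ^ Suc m / real (Suc m)) * (ennreal (sqrt (R\<^sup>2 - z\<^sup>2) ^ m / (R\<^sup>2 - z\<^sup>2) * (R / R ^ m)) * indicator {-R<..<R} z *
       J z) \<partial>lborel)"
  proof (rule nn_integral_cong)
    fix z :: real
    show "ennreal (R\<^sup>2 / sqrt (R\<^sup>2 - z\<^sup>2) ^ 3) * indicator {-R<..<R} z
     * (\<Gamma> (z / sqrt (R\<^sup>2 - z\<^sup>2)) * ennreal ((R / sqrt (1 + (z / sqrt (R\<^sup>2 - z\<^sup>2))\<^sup>2)) ^ Suc m / real (Suc m)))
     = ennreal (R ^ Suc m / real (Suc m)) * (ennreal (sqrt (R\<^sup>2 - z\<^sup>2) ^ m / (R\<^sup>2 - z\<^sup>2) * (R / R ^ m)) * indicator {-R<..<R} z *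
       J z)"
    proof (cases "z \<in> {-R<..<R}")
      case z: True
      \<comment> \<open>The radius of the slice at \<open>z\<close>. At the slope
        \<open>z / \<rho>\<close> the cut-off radius is again \<open>\<rho>\<close>, so the weights
        reduce to \<open>\<rho>\<close> to the power \<open>m - 2\<close> times powers of
        \<open>R\<close>.\<close>
      define \<rho> where "\<rho> = sqrt (R\<^sup>2 - z\<^sup>2)"
      have \<rho>: "0 < \<rho>" and \<rho>2: "R\<^sup>2 - z\<^sup>2 = \<rho>\<^sup>2" using pos[OF z] by (simp_all add: \<rho>_def)
      have "1 + (z / \<rho>)\<^sup>2 = (R / \<rho>)\<^sup>2"
        using \<rho> \<rho>2 by (simp add: power_divide field_simps)
      then have q: "R / sqrt (1 + (z / \<rho>)\<^sup>2) = \<rho>"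
        using R \<rho> by simp
      have \<Gamma>: "\<Gamma> (z / \<rho>) = J z"
        using \<rho> by (simp add: \<Gamma>_def J_def q vscale_vcons \<rho>_def[symmetric])
      have "ennreal (R\<^sup>2 / \<rho> ^ 3) * ennreal (\<rho> ^ Suc m / real (Suc m))
        = ennreal (R ^ Suc m / real (Suc m)) * ennreal (\<rho> ^ m / \<rho>\<^sup>2 * (R / R ^ m))"
        using R \<rho> by (simp add: ennreal_mult[symmetric] del: of_nat_Suc)
          (simp add: field_simps power2_eq_square power3_eq_cube del: of_nat_Suc)
      then show ?thesis
        using z unfolding \<rho>_def[symmetric] unfolding \<rho>2 q \<Gamma> by (simp add: mult_ac)
    qed simp
  qed
  also have "\<dots> = ennreal (R ^ Suc m / real (Suc m)) * (\<integral>\<^sup>+z. (ennreal (sqrt (R\<^sup>2 - z\<^sup>2) ^ m / (R\<^sup>2 - z\<^sup>2) * (R / R ^ m)) * indicator {-R<..<R} z *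
       J z) \<partial>lborel)"
    (is "_ = _ * ?I") by (rule nn_integral_cmult) measurable
  finally have K: "(\<integral>\<^sup>+x. K x \<partial>RN (Suc m)) = ennreal (sphere_area m) * (ennreal (R ^ Suc m / real (Suc m)) * ?I)" .
  have em: "emeasure (RN (Suc m)) (ball_N (Suc m) R) = ennreal (sphere_area (Suc m) * (R ^ Suc m / real (Suc m)))"
    using R by (subst emeasure_ball_N) (simp_all add: mult_ac)
  have sa: "0 < sphere_area m" "0 < sphere_area (Suc m)" using m sphere_area_pos by auto
  \<comment> \<open>This factor was split off so as to cancel against the volume of the
    ball.\<close>
  define c where "c = R ^ Suc m / real (Suc m)"
  have c: "0 < c" unfolding c_def using R by simp
  have "(\<integral>\<^sup>+x. G x \<partial>sphere_measure (Suc m) R) = (\<integral>\<^sup>+x. K x \<partial>RN (Suc m)) / emeasure (RN (Suc m)) (ball_N (Suc m) R)"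
    unfolding K_def by (rule nn_integral_sphere_measure) fact
  also have "\<dots> = ennreal (sphere_area m) * (ennreal c * ?I) / ennreal (sphere_area (Suc m) * c)"
    unfolding K em c_def ..
  also have "\<dots> = ?I * ((ennreal (sphere_area m) * ennreal c) / ennreal (sphere_area (Suc m) * c))"
    by (simp only: divide_ennreal_def mult_ac)
  also have "(ennreal (sphere_area m) * ennreal c) / ennreal (sphere_area (Suc m) * c) = ennreal (sphere_area m / sphere_area (Suc m))"
    using sa c by (simp add: ennreal_mult[symmetric] divide_ennreal)
  also have "?I = (\<integral>\<^sup>+z. ennreal (sqrt (R\<^sup>2 - z\<^sup>2) ^ m / (R\<^sup>2 - z\<^sup>2) * (R / R ^ m)) * indicator {-R<..<R} z *
       (\<integral>\<^sup>+y. G (vcons m z y) \<partial>sphere_measure m (sqrt (R\<^sup>2 - z\<^sup>2))) \<partial>lborel)"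
  proof (rule nn_integral_cong)
    fix z :: real
    have "J z = (\<integral>\<^sup>+y. G (vcons m z y) \<partial>sphere_measure m (sqrt (R\<^sup>2 - z\<^sup>2)))" if "z \<in> {-R<..<R}"
      unfolding J_def by (rule nn_integral_sphere_measure_rescale[OF m, symmetric])
        (use pos[OF that] in simp, measurable)
    then show "ennreal (sqrt (R\<^sup>2 - z\<^sup>2) ^ m / (R\<^sup>2 - z\<^sup>2) * (R / R ^ m)) * indicator {-R<..<R} z * J z
      = ennreal (sqrt (R\<^sup>2 - z\<^sup>2) ^ m / (R\<^sup>2 - z\<^sup>2) * (R / R ^ m)) * indicator {-R<..<R} z *
       (\<integral>\<^sup>+y. G (vcons m z y) \<partial>sphere_measure m (sqrt (R\<^sup>2 - z\<^sup>2)))"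
      by (cases "z \<in> {-R<..<R}") auto
  qed
  finally show ?thesis by (simp add: mult.commute)
qed

subsection \<open>Reduction to the plane\<close>

text \<open>The weight \<open>u / sqrt u ^ m\<close> is the reciprocal of the density of two coordinates under
  the uniform measure, so that this density cancels.\<close>

lemma nn_integral_sphere_two_coordinates_le:
  fixes h :: "real \<times> real \<Rightarrow> ennreal"
  assumes m: "1 \<le> m" and R: "0 < R" and B: "0 \<le> B"
    and G[measurable]: "G \<in> borel_measurable (RN (Suc (Suc m)))"
    and h[measurable]: "h \<in> borel_measurable (borel \<Otimes>\<^sub>M borel)"
    and T[measurable]: "T \<in> borel_measurable (RN m)"
    and G_eq: "\<And>z\<^sub>1 z\<^sub>2 y. y \<in> space (RN m) \<Longrightarrow> G (vcons (Suc m) z\<^sub>1 (vcons m z\<^sub>2 y)) = h (z\<^sub>1, z\<^sub>2) * T y"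
    and T_le: "\<And>u. 0 < u \<Longrightarrow> (\<integral>\<^sup>+y. T y \<partial>sphere_measure m (sqrt u)) \<le> ennreal (B * (u / sqrt u ^ m))"
  shows "(\<integral>\<^sup>+x. G x \<partial>sphere_measure (Suc (Suc m)) R)
    \<le> ennreal (sphere_area m * B / (sphere_area (Suc (Suc m)) * R ^ m)) * (\<integral>\<^sup>+z\<^sub>1. \<integral>\<^sup>+z\<^sub>2. h (z\<^sub>1, z\<^sub>2) \<partial>lborel \<partial>lborel)"
proof -
  have sa: "0 < sphere_area m" "0 < sphere_area (Suc m)" "0 < sphere_area (Suc (Suc m))"
    using m sphere_area_pos by auto
  have pos: "0 < r\<^sup>2 - z\<^sup>2" if "z \<in> {-r<..<r}" "0 < r" for z r :: real
    using that abs_square_less_1[of "z / r"] by (simp add: power_divide abs_less_iff field_simps)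
  define H where "H z\<^sub>1 = (\<integral>\<^sup>+z\<^sub>2. h (z\<^sub>1, z\<^sub>2) \<partial>lborel)" for z\<^sub>1
  have [measurable]: "H \<in> borel_measurable borel" unfolding H_def by measurable
  \<comment> \<open>The second slice, in the sphere of R^(m+1) that the first one leaves. The bound
    for \<open>T\<close> removes the weight in \<open>z\<close>, and dropping the indicator extends
    the integral to the whole line.\<close>
  have inner: "(\<integral>\<^sup>+y. G (vcons (Suc m) z\<^sub>1 y) \<partial>sphere_measure (Suc m) \<rho>)
      \<le> ennreal (sphere_area m / sphere_area (Suc m) * (\<rho> / \<rho> ^ m) * B) * H z\<^sub>1" if \<rho>: "0 < \<rho>" for \<rho> z\<^sub>1
  proof -
    have "(\<integral>\<^sup>+y. G (vcons (Suc m) z\<^sub>1 y) \<partial>sphere_measure (Suc m) \<rho>)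
      = ennreal (sphere_area m / sphere_area (Suc m)) *
    (\<integral>\<^sup>+z. ennreal (sqrt (\<rho>\<^sup>2 - z\<^sup>2) ^ m / (\<rho>\<^sup>2 - z\<^sup>2) * (\<rho> / \<rho> ^ m)) * indicator {-\<rho><..<\<rho>} z *
       (\<integral>\<^sup>+y. G (vcons (Suc m) z\<^sub>1 (vcons m z y)) \<partial>sphere_measure m (sqrt (\<rho>\<^sup>2 - z\<^sup>2))) \<partial>lborel)"
      by (rule nn_integral_sphere_slice[OF m \<rho>]) measurable
    also have "\<dots> \<le> ennreal (sphere_area m / sphere_area (Suc m)) * (\<integral>\<^sup>+z. ennreal ((\<rho> / \<rho> ^ m) * B) * h (z\<^sub>1, z) \<partial>lborel)"
    proof (intro mult_left_mono nn_integral_mono)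
      fix z :: real
      show "ennreal (sqrt (\<rho>\<^sup>2 - z\<^sup>2) ^ m / (\<rho>\<^sup>2 - z\<^sup>2) * (\<rho> / \<rho> ^ m)) * indicator {-\<rho><..<\<rho>} z *
         (\<integral>\<^sup>+y. G (vcons (Suc m) z\<^sub>1 (vcons m z y)) \<partial>sphere_measure m (sqrt (\<rho>\<^sup>2 - z\<^sup>2)))
         \<le> ennreal ((\<rho> / \<rho> ^ m) * B) * h (z\<^sub>1, z)"
      proof (cases "z \<in> {-\<rho><..<\<rho>}")
        case z: True
        define u where "u = \<rho>\<^sup>2 - z\<^sup>2"
        have u: "0 < u" unfolding u_def using z \<rho> by (rule pos)
        have "(\<integral>\<^sup>+y. G (vcons (Suc m) z\<^sub>1 (vcons m z y)) \<partial>sphere_measure m (sqrt u))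
          = (\<integral>\<^sup>+y. h (z\<^sub>1, z) * T y \<partial>sphere_measure m (sqrt u))"
          using sets_eq_imp_space_eq[OF sets_sphere_measure[of m "sqrt u"]] by (intro nn_integral_cong G_eq) simp
        also have "\<dots> = h (z\<^sub>1, z) * (\<integral>\<^sup>+y. T y \<partial>sphere_measure m (sqrt u))"
          by (rule nn_integral_cmult) measurable
        also have "\<dots> \<le> h (z\<^sub>1, z) * ennreal (B * (u / sqrt u ^ m))"
          using T_le[OF u] by (rule mult_left_mono) simp
        finally have "ennreal (sqrt u ^ m / u * (\<rho> / \<rho> ^ m)) * (\<integral>\<^sup>+y. G (vcons (Suc m) z\<^sub>1 (vcons m z y)) \<partial>sphere_measure m (sqrt u))
          \<le> ennreal (sqrt u ^ m / u * (\<rho> / \<rho> ^ m)) * (h (z\<^sub>1, z) * ennreal (B * (u / sqrt u ^ m)))"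
          by (rule mult_left_mono) simp
        also have "\<dots> = (ennreal (sqrt u ^ m / u * (\<rho> / \<rho> ^ m)) * ennreal (B * (u / sqrt u ^ m))) * h (z\<^sub>1, z)"
          by (simp only: mult_ac)
        also have "ennreal (sqrt u ^ m / u * (\<rho> / \<rho> ^ m)) * ennreal (B * (u / sqrt u ^ m)) = ennreal ((\<rho> / \<rho> ^ m) * B)"
          using u \<rho> B by (simp add: ennreal_mult[symmetric])
        finally show ?thesis using z by (simp add: u_def)
      qed simp
    qed simp
    also have "\<dots> = ennreal (sphere_area m / sphere_area (Suc m)) * (ennreal ((\<rho> / \<rho> ^ m) * B) * H z\<^sub>1)"
      unfolding H_def by (subst nn_integral_cmult) auto
    also have "\<dots> = ennreal (sphere_area m / sphere_area (Suc m) * (\<rho> / \<rho> ^ m) * B) * H z\<^sub>1"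
      using sa \<rho> B by (simp add: ennreal_mult[symmetric] mult.assoc[symmetric] del: times_divide_eq_right times_divide_eq_left)
    finally show ?thesis .
  qed
  have "(\<integral>\<^sup>+x. G x \<partial>sphere_measure (Suc (Suc m)) R) = ennreal (sphere_area (Suc m) / sphere_area (Suc (Suc m))) *
    (\<integral>\<^sup>+z. ennreal (sqrt (R\<^sup>2 - z\<^sup>2) ^ Suc m / (R\<^sup>2 - z\<^sup>2) * (R / R ^ Suc m)) * indicator {-R<..<R} z *
       (\<integral>\<^sup>+y. G (vcons (Suc m) z y) \<partial>sphere_measure (Suc m) (sqrt (R\<^sup>2 - z\<^sup>2))) \<partial>lborel)"
    by (rule nn_integral_sphere_slice[OF _ R G]) simp
  also have "\<dots> \<le> ennreal (sphere_area (Suc m) / sphere_area (Suc (Suc m))) *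
    (\<integral>\<^sup>+z. ennreal (sphere_area m / sphere_area (Suc m) * B / R ^ m) * H z \<partial>lborel)"
  proof (intro mult_left_mono nn_integral_mono)
    fix z :: real
    show "ennreal (sqrt (R\<^sup>2 - z\<^sup>2) ^ Suc m / (R\<^sup>2 - z\<^sup>2) * (R / R ^ Suc m)) * indicator {-R<..<R} z *
       (\<integral>\<^sup>+y. G (vcons (Suc m) z y) \<partial>sphere_measure (Suc m) (sqrt (R\<^sup>2 - z\<^sup>2)))
       \<le> ennreal (sphere_area m / sphere_area (Suc m) * B / R ^ m) * H z"
    proof (cases "z \<in> {-R<..<R}")
      case z: True
      define \<rho> where "\<rho> = sqrt (R\<^sup>2 - z\<^sup>2)"
      have \<rho>: "0 < \<rho>" and \<rho>2: "R\<^sup>2 - z\<^sup>2 = \<rho>\<^sup>2" using pos[OF z R] by (simp_all add: \<rho>_def)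
      have "ennreal (\<rho> ^ Suc m / \<rho>\<^sup>2 * (R / R ^ Suc m)) * (\<integral>\<^sup>+y. G (vcons (Suc m) z y) \<partial>sphere_measure (Suc m) \<rho>)
        \<le> ennreal (\<rho> ^ Suc m / \<rho>\<^sup>2 * (R / R ^ Suc m)) * (ennreal (sphere_area m / sphere_area (Suc m) * (\<rho> / \<rho> ^ m) * B) * H z)"
        using inner[OF \<rho>] by (rule mult_left_mono) simp
      also have "\<dots> = (ennreal (\<rho> ^ Suc m / \<rho>\<^sup>2 * (R / R ^ Suc m)) * ennreal (sphere_area m / sphere_area (Suc m) * (\<rho> / \<rho> ^ m) * B)) * H z"
        by (simp only: mult_ac)
      also have "ennreal (\<rho> ^ Suc m / \<rho>\<^sup>2 * (R / R ^ Suc m)) * ennreal (sphere_area m / sphere_area (Suc m) * (\<rho> / \<rho> ^ m) * B)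
         = ennreal (\<rho> ^ Suc m / \<rho>\<^sup>2 * (R / R ^ Suc m) * (sphere_area m / sphere_area (Suc m) * (\<rho> / \<rho> ^ m) * B))"
        using \<rho> R sa B by (intro ennreal_mult[symmetric]) auto
      \<comment> \<open>The factor \<open>\<rho> / \<rho> ^ m\<close> left by the inner slice
        cancels the weight of the outer one, so the constant no longer depends on
        \<open>z\<close>.\<close>
      also have "\<rho> ^ Suc m / \<rho>\<^sup>2 * (R / R ^ Suc m) * (sphere_area m / sphere_area (Suc m) * (\<rho> / \<rho> ^ m) * B)
        = sphere_area m / sphere_area (Suc m) * B / R ^ m"
        using \<rho> R by (simp add: power2_eq_square)
      finally show ?thesis using z unfolding \<rho>_def[symmetric] unfolding \<rho>2 by (simp add: mult.commute)
    qed simp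
  qed simp
  also have "\<dots> = ennreal (sphere_area (Suc m) / sphere_area (Suc (Suc m))) *
    (ennreal (sphere_area m / sphere_area (Suc m) * B / R ^ m) * (\<integral>\<^sup>+z. H z \<partial>lborel))"
    by (subst nn_integral_cmult) auto
  also have "\<dots> = (ennreal (sphere_area (Suc m) / sphere_area (Suc (Suc m))) *
    ennreal (sphere_area m / sphere_area (Suc m) * B / R ^ m)) * (\<integral>\<^sup>+z. H z \<partial>lborel)"
    by (simp only: mult_ac)
  also have "ennreal (sphere_area (Suc m) / sphere_area (Suc (Suc m))) * ennreal (sphere_area m / sphere_area (Suc m) * B / R ^ m)
      = ennreal (sphere_area m * B / (sphere_area (Suc (Suc m)) * R ^ m))"
    using sa R B by (simp add: ennreal_mult[symmetric])
  finally show ?thesis by (simp add: H_def)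
qed

section \<open>Tensor powers, their rotation and \<open>psi\<close>\<close>

lemma tensor_nonneg: "(\<And>v. 0 \<le> f v) \<Longrightarrow> 0 \<le> tensor f n v"
  by (simp add: tensor_def prod_nonneg)

lemma tensor_measurable [measurable]:
  assumes "f \<in> borel_measurable borel"
  shows "tensor f n \<in> borel_measurable (RN n)"
  unfolding tensor_def
  by (intro borel_measurable_prod measurable_compose[OF measurable_RN_component assms]) auto

lemma tensor_Suc_Suc:
  "tensor f (Suc (Suc m)) v = f (v 0) * f (v 1) * (\<Prod>i<m. f (v (Suc (Suc i))))"
  by (simp add: tensor_def prod.lessThan_Suc_shift del: prod.lessThan_Suc)

lemma tensor_rot12:
  "tensor f (Suc (Suc m)) (rot12 \<theta> v)
     = f (v 0 * cos \<theta> + v 1 * sin \<theta>) * f (- v 0 * sin \<theta> + v 1 * cos \<theta>) * (\<Prod>i<m. f (v (Suc (Suc i))))"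
  by (simp add: tensor_Suc_Suc rot12_def)

text \<open>The difference is homogeneous of degree one, the quotient of degree zero. Hence factors
  common to a density and its rotation come out of \<open>psi\<close>.\<close>

lemma psi_scale:
  assumes "0 < c"
  shows "psi \<beta> (x * c) (y * c) = psi \<beta> x y * c"
proof -
  have "\<bar>x * c - y * c\<bar> = \<bar>x - y\<bar> * c"
    using assms by (simp add: left_diff_distrib[symmetric] abs_mult)
  then show ?thesis using assms by (simp add: psi_def)
qed

text \<open>What is left of the integrand once the factors untouched by the rotation are taken out:
  the two-particle density before and after a collision in Kac's model.\<close>

definition kac_psi :: "real \<Rightarrow> (real \<Rightarrow> real) \<Rightarrow> real \<Rightarrow> real \<times> real \<Rightarrow> real" where
  "kac_psi \<beta> f \<theta> w = psi \<beta> (f (fst w) * f (snd w))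
     (f (fst w * cos \<theta> + snd w * sin \<theta>) * f (- fst w * sin \<theta> + snd w * cos \<theta>))"

lemma kac_psi_measurable [measurable]:
  assumes [measurable]: "f \<in> borel_measurable borel"
  shows "kac_psi \<beta> f \<theta> \<in> borel_measurable (borel \<Otimes>\<^sub>M borel)"
  unfolding kac_psi_def psi_def by measurable

text \<open>The product over the last \<open>m\<close> coordinates, divided by the normalisation,
  comes out of \<open>psi\<close>; its integral over a slice of radius \<open>sqrt u\<close> is
  \<open>ZZ f m (sqrt u)\<close> divided by the normalisation. The bound
  \<open>B * (u / sqrt u ^ m)\<close> has the shape that concentration provides, with
  \<open>B\<close> collecting what does not depend on \<open>u\<close>.\<close>

lemma nn_integral_psi_cond_tensor_le:
  assumes f[measurable]: "f \<in> borel_measurable borel" and f_pos: "\<And>v. 0 < f v"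
    and m: "1 \<le> m" and B: "0 \<le> B" and Z: "0 < ZZ f (Suc (Suc m)) (sqrt (real (Suc (Suc m))))"
    and int: "\<And>r. 0 < r \<Longrightarrow> integrable (sphere_measure m r) (tensor f m)"
    and ZZ_le: "\<And>u. 0 < u \<Longrightarrow> ZZ f m (sqrt u) \<le> B * (u / sqrt u ^ m)"
  shows "(\<integral>\<^sup>+v. ennreal (psi \<beta> (cond_tensor f (Suc (Suc m)) v) (cond_tensor f (Suc (Suc m)) (rot12 \<theta> v)))
       \<partial>sphere_measure (Suc (Suc m)) (sqrt (real (Suc (Suc m)))))
    \<le> ennreal (sphere_area m * (B / ZZ f (Suc (Suc m)) (sqrt (real (Suc (Suc m)))))
         / (sphere_area (Suc (Suc m)) * sqrt (real (Suc (Suc m))) ^ m))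
       * (\<integral>\<^sup>+z\<^sub>1. \<integral>\<^sup>+z\<^sub>2. ennreal (kac_psi \<beta> f \<theta> (z\<^sub>1, z\<^sub>2)) \<partial>lborel \<partial>lborel)"
proof -
  define Z' where "Z' = ZZ f (Suc (Suc m)) (sqrt (real (Suc (Suc m))))"
  have Z': "0 < Z'" using Z by (simp add: Z'_def)
  have psi_eq: "psi \<beta> (cond_tensor f (Suc (Suc m)) v) (cond_tensor f (Suc (Suc m)) (rot12 \<theta> v))
    = kac_psi \<beta> f \<theta> (v 0, v 1) * ((\<Prod>i<m. f (v (Suc (Suc i)))) / Z')" for v
  proof -
    have "0 < (\<Prod>i<m. f (v (Suc (Suc i)))) / Z'"
      using Z' f_pos by (simp add: prod_pos)
    from psi_scale[OF this, of \<beta> "f (v 0) * f (v 1)" "f (v 0 * cos \<theta> + v 1 * sin \<theta>) * f (- v 0 * sin \<theta> + v 1 * cos \<theta>)"]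
    show ?thesis
      unfolding cond_tensor_def Z'_def[symmetric] tensor_rot12
      unfolding tensor_Suc_Suc kac_psi_def by simp
  qed
  have comp: "(\<lambda>v. v i) \<in> borel_measurable (RN (Suc (Suc m)))" if "i < Suc (Suc m)" for i
    by (rule measurable_RN_component[of "\<lambda>v. v" _ "Suc (Suc m)"]) (simp_all add: that)
  have [measurable]: "(\<lambda>v. v 0) \<in> borel_measurable (RN (Suc (Suc m)))" "(\<lambda>v. v 1) \<in> borel_measurable (RN (Suc (Suc m)))"
    "(\<lambda>v. v (Suc 0)) \<in> borel_measurable (RN (Suc (Suc m)))"
    by (auto intro!: comp)
  have [measurable]: "(\<lambda>v. \<Prod>i<m. f (v (Suc (Suc i)))) \<in> borel_measurable (RN (Suc (Suc m)))"
    by (intro borel_measurable_prod measurable_compose[OF comp f]) auto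
  have kac_nonneg: "0 \<le> kac_psi \<beta> f \<theta> w" for w
    by (simp add: kac_psi_def psi_def)
  show ?thesis
    unfolding psi_eq Z'_def[symmetric]
  proof (rule nn_integral_sphere_two_coordinates_le[OF m, where T = "\<lambda>y. ennreal (tensor f m y / Z')"])
    show "(\<lambda>v. ennreal (kac_psi \<beta> f \<theta> (v 0, v 1) * ((\<Prod>i<m. f (v (Suc (Suc i)))) / Z'))) \<in> borel_measurable (RN (Suc (Suc m)))"
      by measurable
    fix z\<^sub>1 z\<^sub>2 y
    have "(\<Prod>i<m. f (vcons (Suc m) z\<^sub>1 (vcons m z\<^sub>2 y) (Suc (Suc i)))) = tensor f m y"
      unfolding tensor_def by (intro prod.cong) auto
    then show "ennreal (kac_psi \<beta> f \<theta> (vcons (Suc m) z\<^sub>1 (vcons m z\<^sub>2 y) 0, vcons (Suc m) z\<^sub>1 (vcons m z\<^sub>2 y) 1)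
       * ((\<Prod>i<m. f (vcons (Suc m) z\<^sub>1 (vcons m z\<^sub>2 y) (Suc (Suc i)))) / Z'))
       = ennreal (kac_psi \<beta> f \<theta> (z\<^sub>1, z\<^sub>2)) * ennreal (tensor f m y / Z')"
      using Z' tensor_nonneg[of f m y] f_pos by (simp add: ennreal_mult[symmetric] kac_nonneg less_imp_le)
  next
    fix u :: real assume u: "0 < u"
    have int': "integrable (sphere_measure m (sqrt u)) (\<lambda>y. tensor f m y / Z')"
      using int[of "sqrt u"] u by simp
    have "(\<integral>\<^sup>+y. ennreal (tensor f m y / Z') \<partial>sphere_measure m (sqrt u)) = ennreal (ZZ f m (sqrt u) / Z')"
      using f_pos Z' by (subst nn_integral_eq_integral[OF int']) (auto simp: ZZ_def tensor_nonneg less_imp_le)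
    also have "\<dots> \<le> ennreal (B / Z' * (u / sqrt u ^ m))"
      using divide_right_mono[OF ZZ_le[OF u], of Z'] Z' by (intro ennreal_leI) (simp add: mult.commute)
    finally show "(\<integral>\<^sup>+y. ennreal (tensor f m y / Z') \<partial>sphere_measure m (sqrt u)) \<le> ennreal (B / Z' * (u / sqrt u ^ m))" .
  qed (use B Z' in auto)
qed

subsection \<open>Pointwise bounds and integrals over the plane\<close>

text \<open>Convexity of the power at the midpoint, multiplied by \<open>2 powr p\<close>.\<close>

lemma powr_add_le:
  assumes "1 \<le> p" "0 < x" "0 < (y::real)"
  shows "(x + y) powr p \<le> 2 powr (p - 1) * (x powr p + y powr p)"
proof -
  have "((1 - 1/2) *\<^sub>R x + (1/2) *\<^sub>R y) powr p \<le> (1 - 1/2) * x powr p + (1/2) * y powr p"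
    using assms by (intro convex_onD[OF powr_convex]) auto
  then have "((x + y) / 2) powr p \<le> (x powr p + y powr p) / 2"
    by (simp add: field_simps)
  then have "(x + y) powr p / 2 powr p \<le> (x powr p + y powr p) / 2"
    using assms by (simp add: powr_divide)
  then show ?thesis
    by (simp add: powr_diff field_simps)
qed

text \<open>The two-term inequality, used for the sum of two pairs and then inside each pair, costs
  \<open>2 powr (p - 1)\<close> each time. With \<open>p = 1 + \<beta>\<close> this is the part
  \<open>2 powr (2 * \<beta>)\<close> of the final constant.\<close>

lemma powr_add4_le:
  assumes p: "1 \<le> p" and pos: "0 < a" "0 < b" "0 < c" "0 < (d::real)"
  shows "(a + b + (c + d)) powr p \<le> 4 powr (p - 1) * (a powr p + b powr p + c powr p + d powr p)"
proof -
  have "(a + b + (c + d)) powr p \<le> 2 powr (p - 1) * ((a + b) powr p + (c + d) powr p)"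
    using pos by (intro powr_add_le[OF p]) auto
  also have "\<dots> \<le> 2 powr (p - 1) * (2 powr (p - 1) * (a powr p + b powr p) + 2 powr (p - 1) * (c powr p + d powr p))"
    using pos by (intro mult_left_mono add_mono powr_add_le[OF p]) auto
  also have "\<dots> = (2 powr (p - 1) * 2 powr (p - 1)) * (a powr p + b powr p + c powr p + d powr p)"
    by (simp add: algebra_simps)
  also have "2 powr (p - 1) * 2 powr (p - 1) = (4::real) powr (p - 1)"
    by (simp add: powr_mult[symmetric])
  finally show ?thesis .
qed

text \<open>As \<open>x\<close> is the larger value, \<open>x - y\<close> is at most
  \<open>x\<close> and the logarithm is nonnegative, so its power is monotone in the four-term
  bound. \<open>A\<close> occurs twice, once for each factor of the larger product.\<close>

lemma psi_le_of_less:
  assumes "0 < \<beta>" "0 < y" "y < x" "0 < A" "0 < b" "0 < c" "ln (x / y) \<le> A + A + (b + c)"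
  shows "psi \<beta> x y \<le> 4 powr \<beta> * (x * (2 * A powr (1 + \<beta>) + b powr (1 + \<beta>) + c powr (1 + \<beta>)))"
proof -
  have "0 \<le> ln (x / y)" using assms by simp
  then have "\<bar>ln (x / y)\<bar> powr (1 + \<beta>) \<le> (A + A + (b + c)) powr (1 + \<beta>)"
    using assms by (intro powr_mono2) auto
  also have "\<dots> \<le> 4 powr (1 + \<beta> - 1) * (A powr (1 + \<beta>) + A powr (1 + \<beta>) + b powr (1 + \<beta>) + c powr (1 + \<beta>))"
    using assms by (intro powr_add4_le) auto
  also have "\<dots> = 4 powr \<beta> * (2 * A powr (1 + \<beta>) + b powr (1 + \<beta>) + c powr (1 + \<beta>))"
    by simp
  finally have "\<bar>x - y\<bar> * \<bar>ln (x / y)\<bar> powr (1 + \<beta>)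
      \<le> x * (4 powr \<beta> * (2 * A powr (1 + \<beta>) + b powr (1 + \<beta>) + c powr (1 + \<beta>)))"
    using assms by (intro mult_mono) auto
  then show ?thesis by (simp add: psi_def mult_ac)
qed

lemma psi_commute:
  assumes "0 < x" "0 < y"
  shows "psi \<beta> x y = psi \<beta> y x"
  using assms by (simp add: psi_def ln_div abs_minus_commute)

text \<open>Only the larger of the two products contributes an upper bound on \<open>f\<close> and only the smaller one
  a lower bound; this is what makes two of the four logarithms bounded by \<open>A\<close>.\<close>

lemma kac_psi_le:
  fixes z\<^sub>1 z\<^sub>2 \<theta> :: real
  assumes \<beta>: "0 < \<beta>" and A: "0 < A" and f_pos: "\<And>v. 0 < f v" and \<Phi>_pos: "\<And>v. 0 < \<Phi> v"
    and upper: "\<And>v. ln (f v) \<le> A" and lower: "\<And>v. - \<Phi> v \<le> ln (f v)"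
  defines "w\<^sub>1 \<equiv> z\<^sub>1 * cos \<theta> + z\<^sub>2 * sin \<theta>" and "w\<^sub>2 \<equiv> - z\<^sub>1 * sin \<theta> + z\<^sub>2 * cos \<theta>"
  shows "kac_psi \<beta> f \<theta> (z\<^sub>1, z\<^sub>2) \<le> 4 powr \<beta> *
    (f z\<^sub>1 * f z\<^sub>2 * (2 * A powr (1 + \<beta>) + \<Phi> w\<^sub>1 powr (1 + \<beta>) + \<Phi> w\<^sub>2 powr (1 + \<beta>))
      + f w\<^sub>1 * f w\<^sub>2 * (2 * A powr (1 + \<beta>) + \<Phi> z\<^sub>1 powr (1 + \<beta>) + \<Phi> z\<^sub>2 powr (1 + \<beta>)))"
proof -
  have one_side: "psi \<beta> (f a * f b) (f c * f d) \<le> 4 powr \<beta> *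
      (f a * f b * (2 * A powr (1 + \<beta>) + \<Phi> c powr (1 + \<beta>) + \<Phi> d powr (1 + \<beta>)))"
    if "f c * f d < f a * f b" for a b c d
  proof (rule psi_le_of_less[OF \<beta> _ that A \<Phi>_pos \<Phi>_pos])
    have "ln (f a * f b / (f c * f d)) = ln (f a) + ln (f b) - (ln (f c) + ln (f d))"
      using f_pos by (simp add: ln_div ln_mult order_less_imp_not_eq2)
    then show "ln (f a * f b / (f c * f d)) \<le> A + A + (\<Phi> c + \<Phi> d)"
      using upper[of a] upper[of b] lower[of c] lower[of d] by linarith
  qed (simp add: f_pos)
  let ?X = "f z\<^sub>1 * f z\<^sub>2 * (2 * A powr (1 + \<beta>) + \<Phi> w\<^sub>1 powr (1 + \<beta>) + \<Phi> w\<^sub>2 powr (1 + \<beta>))"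
  let ?Y = "f w\<^sub>1 * f w\<^sub>2 * (2 * A powr (1 + \<beta>) + \<Phi> z\<^sub>1 powr (1 + \<beta>) + \<Phi> z\<^sub>2 powr (1 + \<beta>))"
  have XY: "0 \<le> ?X" "0 \<le> ?Y"
    using f_pos[THEN less_imp_le] by (auto intro!: mult_nonneg_nonneg add_nonneg_nonneg)
  have "psi \<beta> (f z\<^sub>1 * f z\<^sub>2) (f w\<^sub>1 * f w\<^sub>2) \<le> 4 powr \<beta> * (?X + ?Y)"
  proof (cases "f z\<^sub>1 * f z\<^sub>2" "f w\<^sub>1 * f w\<^sub>2" rule: linorder_cases)
    case less
    have "psi \<beta> (f z\<^sub>1 * f z\<^sub>2) (f w\<^sub>1 * f w\<^sub>2) = psi \<beta> (f w\<^sub>1 * f w\<^sub>2) (f z\<^sub>1 * f z\<^sub>2)"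
      by (rule psi_commute) (simp_all add: f_pos)
    also have "\<dots> \<le> 4 powr \<beta> * ?Y" by (rule one_side[OF less])
    also have "\<dots> \<le> 4 powr \<beta> * (?X + ?Y)" using XY by (intro mult_left_mono) auto
    finally show ?thesis .
  next
    case equal
    then have "psi \<beta> (f z\<^sub>1 * f z\<^sub>2) (f w\<^sub>1 * f w\<^sub>2) = 0" by (simp add: psi_def)
    also have "0 \<le> 4 powr \<beta> * (?X + ?Y)" using add_nonneg_nonneg[OF XY] by (rule mult_nonneg_nonneg[rotated]) simp
    finally show ?thesis .
  next
    case greater
    have "psi \<beta> (f z\<^sub>1 * f z\<^sub>2) (f w\<^sub>1 * f w\<^sub>2) \<le> 4 powr \<beta> * ?X" by (rule one_side[OF greater])
    also have "\<dots> \<le> 4 powr \<beta> * (?X + ?Y)" using XY by (intro mult_left_mono) auto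
    finally show ?thesis .
  qed
  then show ?thesis by (simp add: kac_psi_def w\<^sub>1_def w\<^sub>2_def)
qed

section \<open>Invariance of Lebesgue measure in the plane\<close>

lemma nn_integral_lborel_prod:
  fixes H :: "real \<times> real \<Rightarrow> ennreal"
  assumes "H \<in> borel_measurable borel"
  shows "(\<integral>\<^sup>+w. H w \<partial>lborel) = (\<integral>\<^sup>+x. \<integral>\<^sup>+y. H (x, y) \<partial>lborel \<partial>lborel)"
    and "(\<integral>\<^sup>+w. H w \<partial>lborel) = (\<integral>\<^sup>+y. \<integral>\<^sup>+x. H (x, y) \<partial>lborel \<partial>lborel)"
proof -
  have H: "H \<in> borel_measurable (lborel \<Otimes>\<^sub>M lborel)"
    using assms by (simp add: lborel_prod)
  show 1: "(\<integral>\<^sup>+w. H w \<partial>lborel) = (\<integral>\<^sup>+x. \<integral>\<^sup>+y. H (x, y) \<partial>lborel \<partial>lborel)"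
    using lborel.nn_integral_fst[OF H] by (simp add: lborel_prod)
  then show "(\<integral>\<^sup>+w. H w \<partial>lborel) = (\<integral>\<^sup>+y. \<integral>\<^sup>+x. H (x, y) \<partial>lborel \<partial>lborel)"
    using lborel_pair.Fubini[OF H] by simp
qed

lemma borel_measurable_comp_pair:
  fixes H :: "real \<times> real \<Rightarrow> ennreal" and p q :: "real \<times> real \<Rightarrow> real"
  assumes "H \<in> borel_measurable borel" "continuous_on UNIV p" "continuous_on UNIV q"
  shows "(\<lambda>w. H (p w, q w)) \<in> borel_measurable borel"
  using assms
  by (intro measurable_compose[OF _ assms(1)] borel_measurable_continuous_onI continuous_on_Pair)

text \<open>On each line parallel to the axis of the shear the map is a translation. Tonelli is
  taken with that axis as the inner variable, hence in a different order for the two shears.\<close>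

lemma nn_integral_shear:
  fixes H :: "real \<times> real \<Rightarrow> ennreal"
  assumes H[measurable]: "H \<in> borel_measurable borel"
  shows "(\<integral>\<^sup>+w. H (fst w + a * snd w, snd w) \<partial>lborel) = (\<integral>\<^sup>+w. H w \<partial>lborel)"
    and "(\<integral>\<^sup>+w. H (fst w, snd w + a * fst w) \<partial>lborel) = (\<integral>\<^sup>+w. H w \<partial>lborel)"
proof -
  have sec: "(\<lambda>x. H (x, y)) \<in> borel_measurable borel" "(\<lambda>x. H (y, x)) \<in> borel_measurable borel" for y
    by (rule measurable_compose[OF _ H], simp)+
  have 1: "(\<integral>\<^sup>+x. H (x + c, y) \<partial>lborel) = (\<integral>\<^sup>+x. H (x, y) \<partial>lborel)"
    and 2: "(\<integral>\<^sup>+x. H (y, x + c) \<partial>lborel) = (\<integral>\<^sup>+x. H (y, x) \<partial>lborel)" for c y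
    using nn_integral_real_affine[OF sec(1), of 1 y c] nn_integral_real_affine[OF sec(2), of 1 y c]
    by (simp_all add: add.commute)
  show "(\<integral>\<^sup>+w. H (fst w + a * snd w, snd w) \<partial>lborel) = (\<integral>\<^sup>+w. H w \<partial>lborel)"
    by (subst (1 2) nn_integral_lborel_prod(2)) (simp_all add: 1 H, (intro borel_measurable_comp_pair H continuous_intros)+)
  show "(\<integral>\<^sup>+w. H (fst w, snd w + a * fst w) \<partial>lborel) = (\<integral>\<^sup>+w. H w \<partial>lborel)"
    by (subst (1 2) nn_integral_lborel_prod(1)) (simp_all add: 2 H, (intro borel_measurable_comp_pair H continuous_intros)+)
qed

text \<open>A rotation by an angle other than \<open>\<pi>\<close> is a product of three shears.\<close>

lemma nn_integral_rotation:
  fixes H :: "real \<times> real \<Rightarrow> ennreal"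
  assumes H[measurable]: "H \<in> borel_measurable borel"
  shows "(\<integral>\<^sup>+w. H (fst w * cos \<theta> + snd w * sin \<theta>, - fst w * sin \<theta> + snd w * cos \<theta>) \<partial>lborel) = (\<integral>\<^sup>+w. H w \<partial>lborel)"
proof (cases "cos \<theta> = -1")
  \<comment> \<open>The half-turn, for which the shear parameter \<open>t\<close> below has no
    value, is a reflection in each axis.\<close>
  case True
  then have s: "sin \<theta> = 0" using sin_cos_squared_add[of \<theta>] by simp
  have sec: "(\<lambda>x. H (x, y)) \<in> borel_measurable borel" "(\<lambda>x. H (y, x)) \<in> borel_measurable borel" for y
    by (rule measurable_compose[OF _ H], simp)+
  have 1: "(\<integral>\<^sup>+x. H (- x, y) \<partial>lborel) = (\<integral>\<^sup>+x. H (x, y) \<partial>lborel)"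
    and 2: "(\<integral>\<^sup>+x. H (y, - x) \<partial>lborel) = (\<integral>\<^sup>+x. H (y, x) \<partial>lborel)" for y
    using nn_integral_real_affine[OF sec(1), of "-1" y 0] nn_integral_real_affine[OF sec(2), of "-1" y 0]
    by simp_all
  have "(\<integral>\<^sup>+w. H (- fst w, - snd w) \<partial>lborel) = (\<integral>\<^sup>+w. H (- fst w, snd w) \<partial>lborel)"
    by (subst (1 2) nn_integral_lborel_prod(1)) (simp_all add: 2 H, (intro borel_measurable_comp_pair H continuous_intros)+)
  also have "\<dots> = (\<integral>\<^sup>+w. H w \<partial>lborel)"
    by (subst (1 2) nn_integral_lborel_prod(2)) (simp_all add: 1 H, (intro borel_measurable_comp_pair H continuous_intros)+)
  finally show ?thesis by (simp add: True s)
next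
  case False
  \<comment> \<open>The tangent of \<open>\<theta> / 2\<close>: shears by \<open>t\<close>,
    \<open>- sin \<theta>\<close> and \<open>t\<close>, along alternating axes, compose to the
    rotation by the identities \<open>st\<close> and \<open>tc\<close>.\<close>
  define t where "t = sin \<theta> / (1 + cos \<theta>)"
  have c: "1 + cos \<theta> \<noteq> 0" using False by linarith
  have "sin \<theta> * sin \<theta> = (1 - cos \<theta>) * (1 + cos \<theta>)"
    using sin_cos_squared_add[of \<theta>] by (simp add: power2_eq_square algebra_simps)
  then have st: "sin \<theta> * t = 1 - cos \<theta>" using c by (simp add: t_def)
  have "t + t * cos \<theta> = t * (1 + cos \<theta>)" by (simp add: algebra_simps)
  then have tc: "t + t * cos \<theta> = sin \<theta>" using c by (simp add: t_def)
  have eq1: "(x + t * y) + t * (y + (- sin \<theta>) * (x + t * y)) = x * cos \<theta> + y * sin \<theta>" for x y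
  proof -
    have "(x + t * y) + t * (y + (- sin \<theta>) * (x + t * y)) = x * (1 - sin \<theta> * t) + y * (t + t * (1 - sin \<theta> * t))"
      by (simp add: algebra_simps)
    then show ?thesis by (simp add: st tc)
  qed
  have eq2: "y + (- sin \<theta>) * (x + t * y) = - x * sin \<theta> + y * cos \<theta>" for x y
  proof -
    have "y + (- sin \<theta>) * (x + t * y) = - x * sin \<theta> + y * (1 - sin \<theta> * t)"
      by (simp add: algebra_simps)
    then show ?thesis by (simp add: st)
  qed
  define H\<^sub>1 where "H\<^sub>1 w = H (fst w + t * snd w, snd w)" for w
  define H\<^sub>2 where "H\<^sub>2 w = H\<^sub>1 (fst w, snd w + (- sin \<theta>) * fst w)" for w
  have [measurable]: "H\<^sub>1 \<in> borel_measurable borel" unfolding H\<^sub>1_def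
    by (intro borel_measurable_comp_pair H continuous_intros)
  have [measurable]: "H\<^sub>2 \<in> borel_measurable borel" unfolding H\<^sub>2_def
    by (intro borel_measurable_comp_pair continuous_intros) fact
  have "(\<integral>\<^sup>+w. H w \<partial>lborel) = (\<integral>\<^sup>+w. H\<^sub>1 w \<partial>lborel)"
    unfolding H\<^sub>1_def by (rule nn_integral_shear(1)[symmetric]) fact
  also have "\<dots> = (\<integral>\<^sup>+w. H\<^sub>2 w \<partial>lborel)"
    unfolding H\<^sub>2_def by (rule nn_integral_shear(2)[symmetric]) fact
  also have "\<dots> = (\<integral>\<^sup>+w. H\<^sub>2 (fst w + t * snd w, snd w) \<partial>lborel)"
    by (rule nn_integral_shear(1)[symmetric]) fact
  also have "\<dots> = (\<integral>\<^sup>+w. H (fst w * cos \<theta> + snd w * sin \<theta>, - fst w * sin \<theta> + snd w * cos \<theta>) \<partial>lborel)"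
    unfolding H\<^sub>2_def H\<^sub>1_def fst_conv snd_conv unfolding eq1 unfolding eq2 ..
  finally show ?thesis by simp
qed

section \<open>Integrals over one period\<close>

lemma nn_integral_Icc_Ico:
  fixes h :: "real \<Rightarrow> ennreal"
  shows "(\<integral>\<^sup>+x. h x * indicator {a..b} x \<partial>lborel) = (\<integral>\<^sup>+x. h x * indicator {a..<b} x \<partial>lborel)"
  by (rule nn_integral_cong_AE, rule eventually_mono[OF AE_lborel_singleton[of b]])
     (auto simp: indicator_def)

text \<open>The shifted window is cut at \<open>T\<close>, and the part beyond it is moved back by
  one period. Half-open intervals keep the pieces disjoint; the closed interval differs by a null
  set.\<close>

lemma nn_integral_periodic_shift:
  fixes h :: "real \<Rightarrow> ennreal"
  assumes h[measurable]: "h \<in> borel_measurable borel" and per: "\<And>x. h (x + T) = h x" and c: "0 \<le> c" "c \<le> T"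
  shows "(\<integral>\<^sup>+x. h (x + c) * indicator {0..T} x \<partial>lborel) = (\<integral>\<^sup>+x. h x * indicator {0..T} x \<partial>lborel)"
proof -
  have shift: "(\<integral>\<^sup>+x. k x * indicator {a + d..<b + d} x \<partial>lborel) = (\<integral>\<^sup>+x. k (x + d) * indicator {a..<b} x \<partial>lborel)"
    if [measurable]: "k \<in> borel_measurable borel" for a b d and k :: "real \<Rightarrow> ennreal"
    using nn_integral_real_affine[of "\<lambda>x. k x * indicator {a + d..<b + d} x" 1 d]
    by (simp add: add.commute indicator_def)
  have split: "(\<integral>\<^sup>+x. h x * indicator {a..<b} x \<partial>lborel) = (\<integral>\<^sup>+x. h x * indicator {a..<d} x \<partial>lborel) + (\<integral>\<^sup>+x. h x * indicator {d..<b} x \<partial>lborel)"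
    if "a \<le> d" "d \<le> b" for a b d
    using that by (subst nn_integral_add[symmetric]) (auto intro!: nn_integral_cong simp: indicator_def)
  have "(\<integral>\<^sup>+x. h (x + c) * indicator {0..T} x \<partial>lborel) = (\<integral>\<^sup>+x. h x * indicator {c..<T + c} x \<partial>lborel)"
    unfolding nn_integral_Icc_Ico using shift[of h 0 c T] by simp
  also have "\<dots> = (\<integral>\<^sup>+x. h x * indicator {c..<T} x \<partial>lborel) + (\<integral>\<^sup>+x. h x * indicator {T..<T + c} x \<partial>lborel)"
    using c by (intro split) auto
  also have "(\<integral>\<^sup>+x. h x * indicator {T..<T + c} x \<partial>lborel) = (\<integral>\<^sup>+x. h x * indicator {0..<c} x \<partial>lborel)"
    using shift[of h 0 T c] by (simp add: per add.commute)
  also have "(\<integral>\<^sup>+x. h x * indicator {c..<T} x \<partial>lborel) + \<dots> = (\<integral>\<^sup>+x. h x * indicator {0..<T} x \<partial>lborel)"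
    using split[of 0 c T] c by (simp add: add.commute)
  finally show ?thesis unfolding nn_integral_Icc_Ico .
qed

text \<open>The map from \<open>x\<close> to \<open>T - x\<close> preserves the window, and
  \<open>T - x\<close> differs from \<open>- x\<close> by one period.\<close>

lemma nn_integral_periodic_reflect:
  fixes h :: "real \<Rightarrow> ennreal"
  assumes [measurable]: "h \<in> borel_measurable borel" and per: "\<And>x. h (x + T) = h x"
  shows "(\<integral>\<^sup>+x. h (- x) * indicator {0..T} x \<partial>lborel) = (\<integral>\<^sup>+x. h x * indicator {0..T} x \<partial>lborel)"
proof -
  have "(\<integral>\<^sup>+x. h x * indicator {0..T} x \<partial>lborel) = (\<integral>\<^sup>+x. h (T - x) * indicator {0..T} (T - x) \<partial>lborel)"
    using nn_integral_real_affine[of "\<lambda>x. h x * indicator {0..T} x" "-1" T] by simp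
  also have "\<dots> = (\<integral>\<^sup>+x. h (- x) * indicator {0..T} x \<partial>lborel)"
    using per[of "- x" for x] by (intro nn_integral_cong) (auto simp: indicator_def)
  finally show ?thesis ..
qed

text \<open>\<open>E t w\<close> is the power of \<open>\<Phi>\<close> at the first coordinate of
  \<open>w\<close> turned by \<open>t\<close>. The second coordinate is the first one for the angle
  increased by \<open>pi/2\<close>, and a point is its own image turned back by
  \<open>- \<theta>\<close>, so all four moments in the pointwise bound are values of
  \<open>E\<close>, at the angles collected in \<open>S\<close>. Over a period each integrates to
  \<open>h\<close>, which gives the factor 4; four copies of \<open>A powr (1 + \<beta>)\<close>
  over the length \<open>2 * pi\<close> give \<open>8 * pi\<close>.\<close>

lemma nn_integral_kac_psi_le:
  fixes f \<Phi> :: "real \<Rightarrow> real"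
  assumes f[measurable]: "f \<in> borel_measurable borel" and f_pos: "\<And>v. 0 < f v"
    and f_int: "(\<integral>\<^sup>+v. ennreal (f v) \<partial>lborel) = 1"
    and \<Phi>[measurable]: "\<Phi> \<in> borel_measurable borel" and \<Phi>_pos: "\<And>v. 0 < \<Phi> v"
    and upper: "\<And>v. ln (f v) \<le> A" and lower: "\<And>v. - \<Phi> v \<le> ln (f v)"
    and \<beta>: "0 < \<beta>" and A: "0 < A"
  shows "(\<integral>\<^sup>+\<theta>. (\<integral>\<^sup>+z\<^sub>1. \<integral>\<^sup>+z\<^sub>2. ennreal (kac_psi \<beta> f \<theta> (z\<^sub>1, z\<^sub>2)) \<partial>lborel \<partial>lborel) * indicator {0..2*pi} \<theta> \<partial>lborel)
    \<le> ennreal (4 powr \<beta>) * (ennreal (8 * pi * A powr (1 + \<beta>))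
      + 4 * (\<integral>\<^sup>+w. (\<integral>\<^sup>+\<theta>. ennreal (\<Phi> (fst w * cos \<theta> + snd w * sin \<theta>) powr (1 + \<beta>)) * indicator {0..2*pi} \<theta> \<partial>lborel)
          * ennreal (f (fst w) * f (snd w)) \<partial>(lborel \<Otimes>\<^sub>M lborel)))"
proof -
  let ?W = "lborel \<Otimes>\<^sub>M lborel :: (real \<times> real) measure"
  have sfW: "sigma_finite_measure ?W" by (simp add: lborel_prod sigma_finite_lborel)
  interpret W: sigma_finite_measure ?W by (rule sfW)
  interpret P: pair_sigma_finite "lborel :: real measure" ?W by standard
  define a where "a = ennreal (A powr (1 + \<beta>))"
  define E where "E t w = ennreal (\<Phi> (fst w * cos t + snd w * sin t) powr (1 + \<beta>))" for t and w :: "real \<times> real"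
  define F where "F w = ennreal (f (fst w) * f (snd w))" for w
  have [measurable]: "case_prod E \<in> borel_measurable (borel \<Otimes>\<^sub>M (borel \<Otimes>\<^sub>M borel))"
    unfolding E_def by measurable
  have [measurable]: "F \<in> borel_measurable (borel \<Otimes>\<^sub>M borel)"
    unfolding F_def by measurable
  define S where "S t w = E t w + E (t + pi/2) w + E (- t) w + E (- t + pi/2) w" for t w
  have [measurable]: "case_prod S \<in> borel_measurable (borel \<Otimes>\<^sub>M (borel \<Otimes>\<^sub>M borel))"
    unfolding S_def by measurable
  define h where "h w = (\<integral>\<^sup>+\<theta>. E \<theta> w * indicator {0..2*pi} \<theta> \<partial>lborel)" for w
  have [measurable]: "h \<in> borel_measurable (borel \<Otimes>\<^sub>M borel)"
    unfolding h_def by measurable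
  have rotation: "(\<integral>\<^sup>+w. H (fst w * cos \<theta> + snd w * sin \<theta>, - fst w * sin \<theta> + snd w * cos \<theta>) \<partial>?W) = (\<integral>\<^sup>+w. H w \<partial>?W)"
    if "H \<in> borel_measurable (borel \<Otimes>\<^sub>M borel)" for H \<theta>
    using nn_integral_rotation[of H \<theta>] that by (simp add: lborel_prod borel_prod)
  have plane: "(\<integral>\<^sup>+z\<^sub>1. \<integral>\<^sup>+z\<^sub>2. ennreal (kac_psi \<beta> f \<theta> (z\<^sub>1, z\<^sub>2)) \<partial>lborel \<partial>lborel)
      \<le> ennreal (4 powr \<beta>) * (\<integral>\<^sup>+w. F w * (4 * a + S \<theta> w) \<partial>?W)" for \<theta>
  proof -
    define r where "r w = (fst w * cos \<theta> + snd w * sin \<theta>, - fst w * sin \<theta> + snd w * cos \<theta>)" for w :: "real \<times> real"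
    have E_r: "E (- \<theta>) (r w) = ennreal (\<Phi> (fst w) powr (1 + \<beta>))"
      "E (- \<theta> + pi/2) (r w) = ennreal (\<Phi> (snd w) powr (1 + \<beta>))" for w
    proof -
      have 1: "cos \<theta> * cos \<theta> + sin \<theta> * sin \<theta> = 1"
        using sin_cos_squared_add3[of \<theta>] by simp
      have "fst (r w) * cos (- \<theta>) + snd (r w) * sin (- \<theta>) = fst w * (cos \<theta> * cos \<theta> + sin \<theta> * sin \<theta>)"
        unfolding r_def fst_conv snd_conv cos_minus sin_minus by algebra
      then show "E (- \<theta>) (r w) = ennreal (\<Phi> (fst w) powr (1 + \<beta>))"
        by (simp only: E_def 1 mult_1_right)
      have 2: "cos (- \<theta> + pi/2) = sin \<theta>" "sin (- \<theta> + pi/2) = cos \<theta>"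
        by (simp_all add: cos_diff sin_diff)
      have "fst (r w) * cos (- \<theta> + pi/2) + snd (r w) * sin (- \<theta> + pi/2) = snd w * (cos \<theta> * cos \<theta> + sin \<theta> * sin \<theta>)"
        unfolding r_def fst_conv snd_conv 2 by algebra
      then show "E (- \<theta> + pi/2) (r w) = ennreal (\<Phi> (snd w) powr (1 + \<beta>))"
        by (simp only: E_def 1 mult_1_right)
    qed
    have E_r': "E \<theta> w = ennreal (\<Phi> (fst (r w)) powr (1 + \<beta>))"
      "E (\<theta> + pi/2) w = ennreal (\<Phi> (snd (r w)) powr (1 + \<beta>))" for w
      by (simp_all add: E_def r_def cos_add sin_add)
    have "(\<integral>\<^sup>+z\<^sub>1. \<integral>\<^sup>+z\<^sub>2. ennreal (kac_psi \<beta> f \<theta> (z\<^sub>1, z\<^sub>2)) \<partial>lborel \<partial>lborel) = (\<integral>\<^sup>+w. ennreal (kac_psi \<beta> f \<theta> w) \<partial>?W)"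
      by (rule lborel.nn_integral_fst) measurable
    also have "\<dots> \<le> (\<integral>\<^sup>+w. ennreal (4 powr \<beta>) * (F w * (2 * a + E \<theta> w + E (\<theta> + pi/2) w)
        + F (r w) * (2 * a + E (- \<theta>) (r w) + E (- \<theta> + pi/2) (r w))) \<partial>?W)"
    proof (rule nn_integral_mono)
      fix w :: "real \<times> real"
      have "ennreal (kac_psi \<beta> f \<theta> w) \<le> ennreal (4 powr \<beta> *
          (f (fst w) * f (snd w) * (2 * A powr (1 + \<beta>) + \<Phi> (fst (r w)) powr (1 + \<beta>) + \<Phi> (snd (r w)) powr (1 + \<beta>))
        + f (fst (r w)) * f (snd (r w)) * (2 * A powr (1 + \<beta>) + \<Phi> (fst w) powr (1 + \<beta>) + \<Phi> (snd w) powr (1 + \<beta>))))"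
        using kac_psi_le[where f = f and \<Phi> = \<Phi> and \<theta> = \<theta> and z\<^sub>1 = "fst w" and z\<^sub>2 = "snd w",
          OF \<beta> A f_pos \<Phi>_pos upper lower]
        by (intro ennreal_leI) (simp add: r_def)
      also have "\<dots> = ennreal (4 powr \<beta>) * (F w * (2 * a + E \<theta> w + E (\<theta> + pi/2) w)
        + F (r w) * (2 * a + E (- \<theta>) (r w) + E (- \<theta> + pi/2) (r w)))"
        unfolding E_r E_r' F_def a_def using f_pos[THEN less_imp_le]
        by (simp add: ennreal_mult)
      finally show "ennreal (kac_psi \<beta> f \<theta> w) \<le> \<dots>" .
    qed
    also have "\<dots> = ennreal (4 powr \<beta>) * ((\<integral>\<^sup>+w. F w * (2 * a + E \<theta> w + E (\<theta> + pi/2) w) \<partial>?W)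
        + (\<integral>\<^sup>+w. F (r w) * (2 * a + E (- \<theta>) (r w) + E (- \<theta> + pi/2) (r w)) \<partial>?W))"
      unfolding r_def by (subst nn_integral_cmult, measurable, subst nn_integral_add) auto
    \<comment> \<open>Thanks to the form given by \<open>E_r\<close>, the second half is a function
      of \<open>r w\<close> alone, and rotation invariance replaces \<open>r w\<close> by
      \<open>w\<close>.\<close>
    also have "(\<integral>\<^sup>+w. F (r w) * (2 * a + E (- \<theta>) (r w) + E (- \<theta> + pi/2) (r w)) \<partial>?W)
        = (\<integral>\<^sup>+w. F w * (2 * a + E (- \<theta>) w + E (- \<theta> + pi/2) w) \<partial>?W)"
      unfolding r_def by (rule rotation[of "\<lambda>w. F w * (2 * a + E (- \<theta>) w + E (- \<theta> + pi/2) w)"]) measurable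
    also have "(\<integral>\<^sup>+w. F w * (2 * a + E \<theta> w + E (\<theta> + pi/2) w) \<partial>?W) + \<dots> = (\<integral>\<^sup>+w. F w * (4 * a + S \<theta> w) \<partial>?W)"
    proof (subst nn_integral_add[symmetric])
      have "F w * (2 * a + E \<theta> w + E (\<theta> + pi/2) w) + F w * (2 * a + E (- \<theta>) w + E (- \<theta> + pi/2) w)
        = F w * (4 * a + S \<theta> w)" for w
      proof -
        have 4: "4 * a = 2 * a + 2 * a" by (simp add: distrib_right[symmetric])
        show ?thesis unfolding S_def distrib_left[of "F w", symmetric] unfolding 4 by (simp only: ac_simps)
      qed
      then show "(\<integral>\<^sup>+w. F w * (2 * a + E \<theta> w + E (\<theta> + pi/2) w) + F w * (2 * a + E (- \<theta>) w + E (- \<theta> + pi/2) w) \<partial>?W)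
        = (\<integral>\<^sup>+w. F w * (4 * a + S \<theta> w) \<partial>?W)" by simp
    qed measurable
    finally show ?thesis .
  qed
  have circle: "(\<integral>\<^sup>+\<theta>. (4 * a + S \<theta> w) * indicator {0..2*pi} \<theta> \<partial>lborel) = ennreal (8 * pi * A powr (1 + \<beta>)) + 4 * h w" for w
  proof -
    have [measurable]: "(\<lambda>t. E t w) \<in> borel_measurable borel" unfolding E_def by measurable
    have per: "E (t + 2 * pi) w = E t w" for t by (simp add: E_def)
    have per': "E (t + 2 * pi + pi/2) w = E (t + pi/2) w" for t
      using per[of "t + pi/2"] by (simp add: add_ac)
    have i1: "(\<integral>\<^sup>+\<theta>. E (\<theta> + pi/2) w * indicator {0..2*pi} \<theta> \<partial>lborel) = h w"
      unfolding h_def by (rule nn_integral_periodic_shift[of "\<lambda>t. E t w"]) (use per in auto)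
    have i2: "(\<integral>\<^sup>+\<theta>. E (- \<theta>) w * indicator {0..2*pi} \<theta> \<partial>lborel) = h w"
      unfolding h_def by (rule nn_integral_periodic_reflect[of "\<lambda>t. E t w"]) (use per in auto)
    have i3: "(\<integral>\<^sup>+\<theta>. E (- \<theta> + pi/2) w * indicator {0..2*pi} \<theta> \<partial>lborel) = h w"
      unfolding i1[symmetric] by (rule nn_integral_periodic_reflect[of "\<lambda>t. E (t + pi/2) w"]) (use per' in auto)
    have "(\<integral>\<^sup>+\<theta>. (4 * a + S \<theta> w) * indicator {0..2*pi} \<theta> \<partial>lborel)
      = (\<integral>\<^sup>+\<theta>. 4 * a * indicator {0..2*pi} \<theta> \<partial>lborel) + ((\<integral>\<^sup>+\<theta>. E \<theta> w * indicator {0..2*pi} \<theta> \<partial>lborel)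
        + (\<integral>\<^sup>+\<theta>. E (\<theta> + pi/2) w * indicator {0..2*pi} \<theta> \<partial>lborel) + (\<integral>\<^sup>+\<theta>. E (- \<theta>) w * indicator {0..2*pi} \<theta> \<partial>lborel)
        + (\<integral>\<^sup>+\<theta>. E (- \<theta> + pi/2) w * indicator {0..2*pi} \<theta> \<partial>lborel))"
      unfolding S_def distrib_right by (simp add: nn_integral_add)
    also have "\<dots> = 4 * a * ennreal (2 * pi) + (h w + h w + h w + h w)"
      unfolding i1 i2 i3 h_def[symmetric] by (simp add: nn_integral_cmult_indicator)
    also have "4 * a * ennreal (2 * pi) = ennreal (8 * pi * A powr (1 + \<beta>))"
      unfolding a_def by (simp add: ennreal_mult[symmetric] ennreal_numeral[symmetric] mult_ac del: ennreal_numeral)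
    also have "h w + h w + h w + h w = (1 + 1 + 1 + 1) * h w"
      by (simp only: distrib_right mult_1_left)
    also have "1 + 1 + 1 + 1 = (4 :: ennreal)" by simp
    finally show ?thesis .
  qed
  have F_int: "(\<integral>\<^sup>+w. F w \<partial>?W) = 1"
  proof -
    have "(\<integral>\<^sup>+w. F w \<partial>?W) = (\<integral>\<^sup>+x. \<integral>\<^sup>+y. F (x, y) \<partial>lborel \<partial>lborel)"
      by (rule lborel.nn_integral_fst[symmetric]) measurable
    also have "\<dots> = (\<integral>\<^sup>+x. \<integral>\<^sup>+y. ennreal (f x) * ennreal (f y) \<partial>lborel \<partial>lborel)"
      by (simp add: F_def ennreal_mult f_pos less_imp_le)
    also have "\<dots> = 1"
      by (simp add: nn_integral_cmult f_int)
    finally show ?thesis .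
  qed
  have "(\<integral>\<^sup>+\<theta>. (\<integral>\<^sup>+z\<^sub>1. \<integral>\<^sup>+z\<^sub>2. ennreal (kac_psi \<beta> f \<theta> (z\<^sub>1, z\<^sub>2)) \<partial>lborel \<partial>lborel) * indicator {0..2*pi} \<theta> \<partial>lborel)
    \<le> (\<integral>\<^sup>+\<theta>. ennreal (4 powr \<beta>) * (\<integral>\<^sup>+w. F w * (4 * a + S \<theta> w) \<partial>?W) * indicator {0..2*pi} \<theta> \<partial>lborel)"
    by (intro nn_integral_mono mult_right_mono plane) simp
  also have "\<dots> = ennreal (4 powr \<beta>) * (\<integral>\<^sup>+\<theta>. (\<integral>\<^sup>+w. F w * ((4 * a + S \<theta> w) * indicator {0..2*pi} \<theta>) \<partial>?W) \<partial>lborel)"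
    by (subst nn_integral_cmult[symmetric], measurable, intro nn_integral_cong)
       (simp add: nn_integral_multc[symmetric] mult.assoc)
  \<comment> \<open>After the exchange the angle is integrated with \<open>w\<close> fixed, which is
    the situation of \<open>circle\<close>.\<close>
  also have "(\<integral>\<^sup>+\<theta>. (\<integral>\<^sup>+w. F w * ((4 * a + S \<theta> w) * indicator {0..2*pi} \<theta>) \<partial>?W) \<partial>lborel)
    = (\<integral>\<^sup>+w. (\<integral>\<^sup>+\<theta>. F w * ((4 * a + S \<theta> w) * indicator {0..2*pi} \<theta>) \<partial>lborel) \<partial>?W)"
    by (rule P.Fubini'[symmetric]) measurable
  also have "\<dots> = (\<integral>\<^sup>+w. F w * (ennreal (8 * pi * A powr (1 + \<beta>)) + 4 * h w) \<partial>?W)"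
    unfolding circle[symmetric] by (intro nn_integral_cong nn_integral_cmult) (simp add: space_pair_measure, measurable)
  also have "\<dots> = (\<integral>\<^sup>+w. F w * ennreal (8 * pi * A powr (1 + \<beta>)) + 4 * (h w * F w) \<partial>?W)"
    by (simp add: distrib_left mult_ac)
  also have "\<dots> = ennreal (8 * pi * A powr (1 + \<beta>)) + 4 * (\<integral>\<^sup>+w. h w * F w \<partial>?W)"
    by (simp add: nn_integral_add nn_integral_multc nn_integral_cmult F_int)
  finally show ?thesis
    unfolding h_def E_def F_def .
qed

subsection \<open>The log-power property\<close>

text \<open>Turns the real power in the concentrated form into the natural power of
  \<open>sqrt u\<close> used for slices; dividing by \<open>u\<close> covers \<open>n = 1\<close>,
  where the exponent is negative.\<close>

lemma powr_half_diff_one: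
  assumes "0 < (u::real)"
  shows "u powr ((real n - 2) / 2) = sqrt u ^ n / u"
proof -
  have "u powr ((real n - 2) / 2) = u powr (1/2 * real n - 1)"
    by (simp add: field_simps)
  also have "\<dots> = (u powr (1/2)) powr real n / u"
    using assms by (simp add: powr_diff powr_powr)
  finally show ?thesis using assms by (simp add: powr_half_sqrt powr_realpow)
qed

text \<open>Since \<open>ln x\<close> is at most \<open>x powr \<epsilon> / \<epsilon>\<close>, the
  set is bounded by \<open>1 / \<epsilon>\<close> and its supremum is a genuine upper bound; the
  value at \<open>x = exp 1\<close> makes it positive.\<close>

lemma Sup_ln_over_powr:
  assumes "0 < \<epsilon>"
  defines "C \<equiv> Sup {ln x / x powr \<epsilon> | x. x \<ge> (1::real)}"
  shows "0 < C" and "1 \<le> x \<Longrightarrow> ln x \<le> C * x powr \<epsilon>"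
proof -
  have bdd: "bdd_above {ln x / x powr \<epsilon> | x. x \<ge> (1::real)}"
  proof (rule bdd_aboveI)
    fix y assume "y \<in> {ln x / x powr \<epsilon> | x. x \<ge> (1::real)}"
    then obtain x where x: "1 \<le> x" "y = ln x / x powr \<epsilon>" by auto
    then have "ln x \<le> x powr \<epsilon> / \<epsilon>" using ln_powr_bound[of x \<epsilon>] assms by simp
    then have "y \<le> x powr \<epsilon> / \<epsilon> / x powr \<epsilon>" unfolding x(2) by (rule divide_right_mono) simp
    then show "y \<le> 1 / \<epsilon>" using x(1) by simp
  qed
  have le: "ln x / x powr \<epsilon> \<le> C" if "1 \<le> x" for x
    unfolding C_def using that by (intro cSup_upper[OF _ bdd]) auto
  have "0 < ln (exp 1) / exp 1 powr \<epsilon>" by simp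
  also have "\<dots> \<le> C" by (rule le) simp
  finally show "0 < C" .
  show "ln x \<le> C * x powr \<epsilon>" if "1 \<le> x"
    using le[OF that] that by (simp add: field_simps)
qed

theorem theorem3p5:
  fixes f \<Phi> :: "real \<Rightarrow> real" and g :: "real \<Rightarrow> nat \<Rightarrow> real"
    and lam :: "nat \<Rightarrow> real \<Rightarrow> real" and \<beta> :: real
  assumes dens: "prob_density_unit_moment f"
    and conc: "g_concentrated f g lam"
    and fbdd: "bdd_above (range f)"
    and lam_bdd: "bdd_above {\<bar>lam n u\<bar> | n u. n \<ge> 1 \<and> u > 0}"
    and lam_small: "Sup {\<bar>lam n u\<bar> | n u. n \<ge> 1 \<and> u > 0} < (2 * pi) powr (-1/2)"
    and Phi_meas: "\<Phi> \<in> borel_measurable borel"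
    and Phi_pos: "\<forall>v. 0 < \<Phi> v"
    and f_lower: "\<forall>v. exp (- \<Phi> v) \<le> f v"
    and beta_pos: "0 < \<beta>"
    and M_fin: "(\<integral>\<^sup>+ v. ennreal (\<Phi> v powr (1 + \<beta>) * f v) \<partial>lborel) < \<infinity>"
    and Mavg_fin: "(\<integral>\<^sup>+ w. (\<integral>\<^sup>+ \<theta>. ennreal (\<Phi> (fst w * cos \<theta> + snd w * sin \<theta>) powr (1 + \<beta>))
                          * indicator {0..2*pi} \<theta> \<partial>lborel) * ennreal (f (fst w) * f (snd w))
                   \<partial>(lborel \<Otimes>\<^sub>M lborel)) < \<infinity>"
  shows "\<forall>\<epsilon>>0.
    (let M = enn2real (\<integral>\<^sup>+ v. ennreal (\<Phi> v powr (1 + \<beta>) * f v) \<partial>lborel);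
         Mavg = enn2real (\<integral>\<^sup>+ w. (\<integral>\<^sup>+ \<theta>. ennreal (\<Phi> (fst w * cos \<theta> + snd w * sin \<theta>) powr (1 + \<beta>))
                          * indicator {0..2*pi} \<theta> \<partial>lborel) * ennreal (f (fst w) * f (snd w))
                   \<partial>(lborel \<Otimes>\<^sub>M lborel));
         finf = Sup (range f);
         ginf = Sup {g x n | x n. n \<ge> 1};
         Lam = Sup {\<bar>lam n u\<bar> | n u. n \<ge> 1 \<and> u > 0};
         C\<epsilon> = Sup {ln x / x powr \<epsilon> | x. x \<ge> 1}
     in log_power_property {N. N \<ge> 3} (cond_tensor f) \<beta>
          ((2 powr (1 + 2 * \<beta>) * sqrt 3 * ((ginf + Lam) / ((2 * pi) powr (-1/2) - Lam))
             * (2 * (C\<epsilon> * finf powr \<epsilon>) powr (1 + \<beta>) + M + Mavg)) powr (1 / (1 + \<beta>))))"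
proof (intro allI impI)
  fix \<epsilon> :: real assume \<epsilon>: "0 < \<epsilon>"
  define M where "M = enn2real (\<integral>\<^sup>+ v. ennreal (\<Phi> v powr (1 + \<beta>) * f v) \<partial>lborel)"
  define Mavg where "Mavg = enn2real (\<integral>\<^sup>+ w. (\<integral>\<^sup>+ \<theta>. ennreal (\<Phi> (fst w * cos \<theta> + snd w * sin \<theta>) powr (1 + \<beta>))
                          * indicator {0..2*pi} \<theta> \<partial>lborel) * ennreal (f (fst w) * f (snd w))
                   \<partial>(lborel \<Otimes>\<^sub>M lborel))"
  define finf where "finf = Sup (range f)"
  define ginf where "ginf = Sup {g x n | x n. n \<ge> 1}"
  define Lam where "Lam = Sup {\<bar>lam n u\<bar> | n u. n \<ge> 1 \<and> u > 0}"
  define Ce where "Ce = Sup {ln x / x powr \<epsilon> | x. x \<ge> (1::real)}"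
  define c0 :: real where "c0 = (2 * pi) powr (-1/2)"
  define A where "A = Ce * finf powr \<epsilon>"
  define K where "K = (ginf + Lam) / (c0 - Lam)"
  define X where "X = 2 powr (1 + 2 * \<beta>) * sqrt 3 * K * (2 * A powr (1 + \<beta>) + M + Mavg)"
  have f_meas[measurable]: "f \<in> borel_measurable borel" and f_nn: "\<And>v. 0 \<le> f v"
    and f_hbi: "has_bochner_integral lborel f 1"
    using dens by (auto simp: prob_density_unit_moment_def)
  have f_int: "(\<integral>\<^sup>+v. ennreal (f v) \<partial>lborel) = 1"
    using f_hbi f_nn by (subst nn_integral_eq_integral) (auto simp: has_bochner_integral_iff)
  have f_pos: "0 < f v" for v
    using f_lower exp_gt_zero[of "- \<Phi> v"] by (meson less_le_trans)
  have f_le: "f v \<le> finf" for v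
    unfolding finf_def using fbdd by (intro cSup_upper) auto
  have finf: "0 < finf" using f_pos[of 0] f_le[of 0] by simp
  have Ce: "0 < Ce" "\<And>x. 1 \<le> x \<Longrightarrow> ln x \<le> Ce * x powr \<epsilon>"
    unfolding Ce_def using Sup_ln_over_powr[OF \<epsilon>] by auto
  have A: "0 < A" using Ce finf by (simp add: A_def)
  have upper: "ln (f v) \<le> A" for v
  proof (cases "1 \<le> f v")
    case True
    then have "ln (f v) \<le> Ce * f v powr \<epsilon>" by (rule Ce)
    also have "\<dots> \<le> A" unfolding A_def
      using f_le f_pos[of v] \<epsilon> Ce(1) by (intro mult_left_mono powr_mono2) auto
    finally show ?thesis .
  next
    case False
    then have "ln (f v) < 0" using f_pos[of v] by simp
    then show ?thesis using A by simp
  qed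
  have lower: "- \<Phi> v \<le> ln (f v)" for v
    using f_lower f_pos[of v] by (simp add: ln_ge_iff)
  have lam_le: "\<bar>lam n u\<bar> \<le> Lam" if "1 \<le> n" "0 < u" for n u
    unfolding Lam_def using that by (intro cSup_upper[OF _ lam_bdd]) auto
  \<comment> \<open>The strict inequality keeps the denominators \<open>c0 - Lam\<close> and, later,
    \<open>c0 + y\<close> positive.\<close>
  have Lam: "0 \<le> Lam" "Lam < c0"
    using lam_le[of 1 1] lam_small by (auto simp: Lam_def c0_def)
  have int: "\<And>n r. 1 \<le> n \<Longrightarrow> 0 < r \<Longrightarrow> integrable (sphere_measure n r) (tensor f n)"
    and ZZ: "\<And>n u. 1 \<le> n \<Longrightarrow> 0 < u \<Longrightarrow> ZZ f n (sqrt u) =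
        2 / (sqrt (real n) * sphere_area n * u powr ((real n - 2) / 2)) * (g (u - real n) n + lam n u)"
    and g0: "\<And>n. g 0 n = c0"
    using conc by (auto simp: g_concentrated_def c0_def)
  have g_le: "g x n \<le> ginf" if "1 \<le> n" for x n
  proof -
    obtain b where "\<And>x n. g x n \<le> b" using conc by (auto simp: g_concentrated_def)
    then have "bdd_above {g x n | x n. n \<ge> 1}" by (intro bdd_aboveI[of _ b]) auto
    then show ?thesis unfolding ginf_def using that by (intro cSup_upper) auto
  qed
  have ginf: "c0 \<le> ginf" using g_le[of 1 0] g0 by simp
  have K: "0 < K" unfolding K_def using ginf Lam by (intro divide_pos_pos) auto
  have MM: "0 \<le> M" "0 \<le> Mavg" by (simp_all add: M_def Mavg_def)
  have X: "0 < X"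
    unfolding X_def using K A MM by (intro mult_pos_pos add_pos_nonneg) auto
  define b where "b = (\<integral>\<^sup>+\<theta>. (\<integral>\<^sup>+z\<^sub>1. \<integral>\<^sup>+z\<^sub>2. ennreal (kac_psi \<beta> f \<theta> (z\<^sub>1, z\<^sub>2)) \<partial>lborel \<partial>lborel) * indicator {0..2*pi} \<theta> \<partial>lborel)"
  \<comment> \<open>Finiteness of the averaged moment makes \<open>Mavg\<close> its true value, as
    \<open>enn2real\<close> would send infinity to 0.\<close>
  have b: "b \<le> ennreal (4 powr \<beta> * (8 * pi * A powr (1 + \<beta>) + 4 * Mavg))"
  proof -
    have "b \<le> ennreal (4 powr \<beta>) * (ennreal (8 * pi * A powr (1 + \<beta>)) + 4 * ennreal Mavg)"
      using nn_integral_kac_psi_le[where f = f and \<Phi> = \<Phi>, OF f_meas f_pos f_int Phi_meas _ upper lower beta_pos A] Phi_pos Mavg_fin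
      unfolding b_def Mavg_def by simp
    also have "\<dots> = ennreal (4 powr \<beta> * (8 * pi * A powr (1 + \<beta>) + 4 * Mavg))"
      using MM by (simp add: ennreal_mult)
    finally show ?thesis .
  qed
  have bound: "ennreal (1 / (2 * pi)) *
        (\<integral>\<^sup>+ \<theta>. (\<integral>\<^sup>+ v. ennreal (psi \<beta> (cond_tensor f N v) (cond_tensor f N (rot12 \<theta> v)))
                       \<partial>sphere_measure N (sqrt (real N))) * indicator {0..2*pi} \<theta> \<partial>lborel) \<le> ennreal X"
    if "3 \<le> N" for N
  proof -
    \<comment> \<open>Here \<open>N\<close> at least 3 enters: two slices leave a sphere in R^m with
      \<open>m\<close> at least 1.\<close>
    define m where "m = N - 2"
    have N: "N = Suc (Suc m)" and m: "1 \<le> m" using that by (simp_all add: m_def)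
    have sa: "0 < sphere_area m" "0 < sphere_area N" using m N sphere_area_pos by auto
    \<comment> \<open>The concentrated form of \<open>ZZ f m\<close> with its numerator at the upper
      bound and the power of \<open>u\<close> left out.\<close>
    define B where "B = 2 * (ginf + Lam) / (sqrt (real m) * sphere_area m)"
    have B: "0 \<le> B" using ginf Lam sa by (simp add: B_def)
    define Z where "Z = ZZ f N (sqrt (real N))"
    have N_pos: "0 < real N" using that by simp
    have "sqrt (real N) ^ N = real N * sqrt (real N) ^ m"
      using N_pos by (subst (2) N) (simp add: mult.assoc[symmetric])
    then have Nm: "real N powr ((real N - 2) / 2) = sqrt (real N) ^ m"
      using powr_half_diff_one[OF N_pos, of N] N_pos by simp
    \<comment> \<open>At \<open>u = N\<close> the first argument of \<open>g\<close> is 0, so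
      \<open>g\<close> has the value \<open>c0\<close> and only this error term has to be estimated
      in the denominator.\<close>
    define y where "y = lam N (real N)"
    have y: "\<bar>y\<bar> \<le> Lam" unfolding y_def using N by (intro lam_le) auto
    have Z: "Z = 2 * (c0 + y) / (sqrt (real N) * sphere_area N * sqrt (real N) ^ m)"
      using ZZ[of N "real N"] that unfolding Z_def Nm by (simp add: g0 y_def)
    have Z_pos: "0 < Z"
      unfolding Z using y Lam sa N by (intro divide_pos_pos mult_pos_pos) auto
    have ZZ_le: "ZZ f m (sqrt u) \<le> B * (u / sqrt u ^ m)" if u: "0 < u" for u
    proof -
      have "ZZ f m (sqrt u) = 2 / (sqrt (real m) * sphere_area m * (sqrt u ^ m / u)) * (g (u - real m) m + lam m u)"
        using ZZ[OF m u] by (simp only: powr_half_diff_one[OF u])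
      also have "\<dots> \<le> 2 / (sqrt (real m) * sphere_area m * (sqrt u ^ m / u)) * (ginf + Lam)"
        using g_le[OF m, of "u - real m"] lam_le[OF m u] u sa by (intro mult_left_mono) auto
      also have "\<dots> = B * (u / sqrt u ^ m)"
        using u by (simp add: B_def mult_ac)
      finally show ?thesis .
    qed
    define k where "k = sphere_area m * (B / Z) / (sphere_area N * sqrt (real N) ^ m)"
    have k_nn: "0 \<le> k" using B Z_pos sa by (simp add: k_def)
    \<comment> \<open>Sphere areas and powers of \<open>sqrt N\<close> cancel. The prefactors leave
      the square root of N/(N-2), and this quotient is at most 3 for \<open>N\<close> at least
      3.\<close>
    have k_le: "k \<le> sqrt 3 * K"
    proof -
      have quotient: "s * (2 * e / (r * s) / (2 * d / (n * t * q))) / (t * q) = n / r * (e / d)"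
        if "s \<noteq> 0" "t \<noteq> 0" "q \<noteq> 0" for s e r d n t q :: real
        using that by simp
      have "k = sqrt (real N) / sqrt (real m) * ((ginf + Lam) / (c0 + y))"
        unfolding k_def B_def Z using sa N_pos by (intro quotient) auto
      also have "\<dots> \<le> sqrt 3 * K"
      proof (rule mult_mono)
        show "sqrt (real N) / sqrt (real m) \<le> sqrt 3"
          unfolding real_sqrt_divide[symmetric] using m by (simp add: N field_simps)
        show "(ginf + Lam) / (c0 + y) \<le> K"
          unfolding K_def using y Lam ginf by (intro divide_left_mono mult_pos_pos) auto
      qed (use y Lam ginf in auto)
      finally show ?thesis .
    qed
    have "(\<integral>\<^sup>+ \<theta>. (\<integral>\<^sup>+ v. ennreal (psi \<beta> (cond_tensor f N v) (cond_tensor f N (rot12 \<theta> v)))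
                       \<partial>sphere_measure N (sqrt (real N))) * indicator {0..2*pi} \<theta> \<partial>lborel)
      \<le> (\<integral>\<^sup>+ \<theta>. ennreal k * ((\<integral>\<^sup>+z\<^sub>1. \<integral>\<^sup>+z\<^sub>2. ennreal (kac_psi \<beta> f \<theta> (z\<^sub>1, z\<^sub>2)) \<partial>lborel \<partial>lborel) * indicator {0..2*pi} \<theta>) \<partial>lborel)"
      unfolding mult.assoc[symmetric] k_def Z_def N
      using Z_pos int[OF m] ZZ_le
      by (intro nn_integral_mono mult_right_mono nn_integral_psi_cond_tensor_le[OF f_meas f_pos m B]) (auto simp: Z_def N)
    \<comment> \<open>Integrating over \<open>\<theta>\<close> calls for joint measurability in the
      angle and the coordinates, whereas \<open>kac_psi_measurable\<close> fixes the angle; hence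
      the unfolding.\<close>
    also have "\<dots> = ennreal k * b"
      unfolding b_def kac_psi_def psi_def by (rule nn_integral_cmult) measurable
    also have "\<dots> \<le> ennreal (sqrt 3 * K) * ennreal (4 powr \<beta> * (8 * pi * A powr (1 + \<beta>) + 4 * Mavg))"
      using b k_le by (intro mult_mono ennreal_leI) auto
    finally have "ennreal (1 / (2 * pi)) *
        (\<integral>\<^sup>+ \<theta>. (\<integral>\<^sup>+ v. ennreal (psi \<beta> (cond_tensor f N v) (cond_tensor f N (rot12 \<theta> v)))
                       \<partial>sphere_measure N (sqrt (real N))) * indicator {0..2*pi} \<theta> \<partial>lborel)
      \<le> ennreal (1 / (2 * pi)) * (ennreal (sqrt 3 * K) * ennreal (4 powr \<beta> * (8 * pi * A powr (1 + \<beta>) + 4 * Mavg)))"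
      by (rule mult_left_mono) simp
    also have "\<dots> = ennreal (1 / (2 * pi) * (sqrt 3 * K * (4 powr \<beta> * (8 * pi * A powr (1 + \<beta>) + 4 * Mavg))))"
      using K MM by (simp add: ennreal_mult'[symmetric])
    \<comment> \<open>The normalised angle turns \<open>8 * pi\<close> into 4, that is, 2 times the
      2 inside the bracket, and \<open>4 * Mavg\<close> into 2 times \<open>Mavg / pi\<close>; the
      averaged moment itself carries no normalisation of the angle.\<close>
    also have "1 / (2 * pi) * (sqrt 3 * K * (4 powr \<beta> * (8 * pi * A powr (1 + \<beta>) + 4 * Mavg)))
        = 2 * 4 powr \<beta> * sqrt 3 * K * (2 * A powr (1 + \<beta>) + Mavg / pi)"
      by (simp add: field_simps)
    also have "\<dots> \<le> 2 * 4 powr \<beta> * sqrt 3 * K * (2 * A powr (1 + \<beta>) + M + Mavg)"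
    proof -
      have "Mavg / pi \<le> Mavg / 1" using MM pi_gt3 by (intro divide_left_mono) auto
      then show ?thesis using MM K by (intro mult_left_mono) auto
    qed
    also have "2 * 4 powr \<beta> = (2::real) powr (1 + 2 * \<beta>)"
      using powr_powr[of 2 2 \<beta>] by (simp add: powr_add)
    finally show ?thesis by (simp add: X_def ennreal_leI)
  qed
  have "(X powr (1 / (1 + \<beta>))) powr (1 + \<beta>) = X"
    using X beta_pos by (simp add: powr_powr)
  then have "log_power_property {N. N \<ge> 3} (cond_tensor f) \<beta> (X powr (1 / (1 + \<beta>)))"
    unfolding log_power_property_def using bound X beta_pos by auto
  then show "(let M = enn2real (\<integral>\<^sup>+ v. ennreal (\<Phi> v powr (1 + \<beta>) * f v) \<partial>lborel);
         Mavg = enn2real (\<integral>\<^sup>+ w. (\<integral>\<^sup>+ \<theta>. ennreal (\<Phi> (fst w * cos \<theta> + snd w * sin \<theta>) powr (1 + \<beta>))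
                          * indicator {0..2*pi} \<theta> \<partial>lborel) * ennreal (f (fst w) * f (snd w))
                   \<partial>(lborel \<Otimes>\<^sub>M lborel));
         finf = Sup (range f);
         ginf = Sup {g x n | x n. n \<ge> 1};
         Lam = Sup {\<bar>lam n u\<bar> | n u. n \<ge> 1 \<and> u > 0};
         C\<epsilon> = Sup {ln x / x powr \<epsilon> | x. x \<ge> 1}
     in log_power_property {N. N \<ge> 3} (cond_tensor f) \<beta>
          ((2 powr (1 + 2 * \<beta>) * sqrt 3 * ((ginf + Lam) / ((2 * pi) powr (-1/2) - Lam))
             * (2 * (C\<epsilon> * finf powr \<epsilon>) powr (1 + \<beta>) + M + Mavg)) powr (1 / (1 + \<beta>))))"
    unfolding Let_def X_def K_def A_def M_def Mavg_def finf_def ginf_def Lam_def Ce_def c0_def .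
qed

end
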